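(* Let $P$ be a 3-colorable convex polytope with $2n$ vertices, with a fixed proper coloring of its faces by $1,2,3$, let $m_i$ be the number of faces colored by $i$, and let $\widetilde P$ be the convex hull of the face-vertex incident vectors of $P$, with vertex set $S=V_1\cup V_2\cup V_3$. Suppose $m_3>m_2=m_1\geq 2$. Then a Gale diagram of $\widetilde P$ lies in $\mathbb{R}$ and consists of the point $0$ with multiplicity $m_3$, the point $1$ with multiplicity $m_2$, and the point $-1$ with multiplicity $m_1$. Hence: (1) for $J\subsetneq S$, $\operatorname{conv}(J)$ is a proper face of $\widetilde P$ if and only if either ($V_1\not\subseteq J$ and $V_2\not\subseteq J$) or $V_1\cup V_2\subseteq J$; (2) $\widetilde P$ is not a simplicial convex polytope; (3) $\widetilde P$ is combinatorially equivalent to an $m_3$-fold $n$-pyramid (denoted $T^{n,m_3}_{m_2-1}$) with basis $C(2m_2,2m_2-2)$, the $(2m_2-2)$-dimensional cyclic polytope with $2m_2$ vertices.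
   Context: A convex polytope $P$ is 3-colorable if it is 3-dimensional and simple (each vertex belongs to exactly three 2-dimensional faces) and each facet can be assigned a color in $\{1,2,3\}$ so that adjacent facets have different colors. "Face of $P$" means 2-dimensional face. Such a $P$ has an even number $2n$ of vertices and $n+2$ faces. Identify the vertex set of $P$ with $\{1,\dots,2n\}$. For a face $f$ of $P$, $\xi_f\in\{0,1\}^{2n}\subseteq\mathbb{R}^{2n}$ (the face-vertex incident vector) has entry $1$ at $v$ if $v\in f$ and $0$ otherwise. Let $S=\{\xi_f: f\text{ a face of }P\}$, $\widetilde P=\operatorname{conv}(S)$. The vertex set of $\widetilde P$ is exactly $S$, of size $n+2$. Put $V_i=\{\xi_f: f\text{ is colored by }i\}$, so $|V_i|=m_i$. Gale transform/diagram: for a list $v_1,\dots,v_N$ of column vectors in a Euclidean space with $d=\dim\operatorname{conv}\{v_1,\dots,v_N\}$, choose a basis $\beta_1,\dots,\beta_{N-d-1}$ of the null space of the matrix $\begin{bmatrix}1&\cdots&1\\ v_1&\cdots&v_N\end{bmatrix}$ and let $\bar v_j\in\mathbb{R}^{N-d-1}$ be the $j$-th row of $[\beta_1,\dots,\beta_{N-d-1}]$. The multiset $\{\bar v_j\}$ is a Gale transform. Replacing each nonzero $\bar v_j$ by $\bar v_j/\|\bar v_j\|$ (and leaving zero vectors as $0$) gives a Gale diagram. A Gale diagram of a polytope is one of its vertex set. A proper face is a face different from the whole polytope (the empty face is allowed). A polytope is simplicial if all its proper faces are simplices. A $d$-pyramid with basis $K$ is the convex hull of a $(d-1)$-polytope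 $K$ and a point (apex) outside the affine hull of $K$. A $0$-fold pyramid with basis $K$ is $K$ itself, and an $r$-fold $d$-pyramid with basis $K$ is a $d$-pyramid whose basis is an $(r-1)$-fold $(d-1)$-pyramid with basis $K$. $C(v,d)$ is the cyclic $d$-polytope with $v$ vertices (convex hull of $v$ distinct points on the moment curve in $\mathbb{R}^d$). Two polytopes are combinatorially equivalent if their face lattices are isomorphic. *)

theory Defs
  imports "HOL-Analysis.Analysis" "HOL-Library.Multiset"
begin

definition two_faces :: "'a::euclidean_space set \<Rightarrow> 'a set set" where
  "two_faces P = {f. f face_of P \<and> aff_dim f = 2}"

definition simple_3_polytope :: "'a::euclidean_space set \<Rightarrow> bool" where
  "simple_3_polytope P \<longleftrightarrow>
     polytope P \<and> aff_dim P = 3 \<and>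
     (\<forall>x. x extreme_point_of P \<longrightarrow> card {f \<in> two_faces P. x \<in> f} = 3)"

text \<open>Facets are adjacent if they are distinct and share an edge.\<close>

definition adjacent_facets :: "'a::euclidean_space set \<Rightarrow> 'a set \<Rightarrow> 'a set \<Rightarrow> bool" where
  "adjacent_facets P f g \<longleftrightarrow>
     f \<in> two_faces P \<and> g \<in> two_faces P \<and> f \<noteq> g \<and> (\<exists>e. e edge_of P \<and> e \<subseteq> f \<inter> g)"

definition proper_3_coloring :: "'a::euclidean_space set \<Rightarrow> ('a set \<Rightarrow> nat) \<Rightarrow> bool" where
  "proper_3_coloring P c \<longleftrightarrow>
     c ` two_faces P \<subseteq> {1, 2, 3} \<and> (\<forall>f g. adjacent_facets P f g \<longrightarrow> c f \<noteq> c g)"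

definition three_colorable :: "'a::euclidean_space set \<Rightarrow> bool" where
  "three_colorable P \<longleftrightarrow> simple_3_polytope P \<and> (\<exists>c. proper_3_coloring P c)"

definition color_class :: "'a::euclidean_space set \<Rightarrow> ('a set \<Rightarrow> nat) \<Rightarrow> nat \<Rightarrow> 'a set set" where
  "color_class P c i = {f \<in> two_faces P. c f = i}"

text \<open>A labelling \<open>l\<close>, meant to be a bijection from the finite index type \<open>'v\<close> onto the
  vertices of the polytope, identifies the vertex set with the index set of the coordinates.\<close>

definition incidence_vector :: "('v::finite \<Rightarrow> 'a) \<Rightarrow> 'a set \<Rightarrow> real ^ 'v" where
  "incidence_vector l f = (\<chi> i. if l i \<in> f then 1 else 0)"

definition incidence_polytope ::
    "('v::finite \<Rightarrow> 'a::euclidean_space) \<Rightarrow> 'a set \<Rightarrow> (real ^ 'v) set" where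
  "incidence_polytope l P = convex hull (incidence_vector l ` two_faces P)"

text \<open>Membership in the null space of the matrix with columns \<open>(1, v\<^sub>j)\<close>.
  Only the values of \<open>z\<close> below the length of the list matter.\<close>

definition affine_relation :: "'a::real_vector list \<Rightarrow> (nat \<Rightarrow> real) \<Rightarrow> bool" where
  "affine_relation vs z \<longleftrightarrow>
     (\<Sum>j<length vs. z j) = 0 \<and> (\<Sum>j<length vs. z j *\<^sub>R vs ! j) = 0"

definition affine_relation_basis ::
    "'a::real_vector list \<Rightarrow> 'i set \<Rightarrow> ('i \<Rightarrow> nat \<Rightarrow> real) \<Rightarrow> bool" where
  "affine_relation_basis vs I \<beta> \<longleftrightarrow>
     finite I \<and>
     (\<forall>i\<in>I. affine_relation vs (\<beta> i)) \<and>
     (\<forall>c. (\<forall>j<length vs. (\<Sum>i\<in>I. c i * \<beta> i j) = 0) \<longrightarrow> (\<forall>i\<in>I. c i = 0)) \<and>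
     (\<forall>z. affine_relation vs z \<longrightarrow>
        (\<exists>c. \<forall>j<length vs. z j = (\<Sum>i\<in>I. c i * \<beta> i j)))"

text \<open>The space \<open>\<real>\<^sup>N\<^sup>-\<^sup>d\<^sup>-\<^sup>1\<close> containing the transform is a Euclidean space \<open>'b\<close> of that
  dimension (so \<open>N > d + 1\<close>); the null space basis is indexed by its standard basis, and the
  \<open>j\<close>-th row of \<open>[\<beta>\<^sub>1, \<dots>]\<close> becomes the vector of \<open>'b\<close> with those coordinates.\<close>

definition gale_transform ::
    "'a::euclidean_space list \<Rightarrow> 'b::euclidean_space list \<Rightarrow> bool" where
  "gale_transform vs gs \<longleftrightarrow>
     int DIM('b) = int (length vs) - aff_dim (convex hull (set vs)) - 1 \<and>
     (\<exists>\<beta>. affine_relation_basis vs (Basis :: 'b set) \<beta> \<and>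
        gs = map (\<lambda>j. \<Sum>b\<in>Basis. \<beta> b j *\<^sub>R b) [0..<length vs])"

text \<open>\<open>sgn x\<close> is \<open>x\<close> divided by its norm, and \<open>0\<close> for \<open>x = 0\<close>.\<close>

definition gale_diagram ::
    "'a::euclidean_space list \<Rightarrow> 'b::euclidean_space multiset \<Rightarrow> bool" where
  "gale_diagram vs D \<longleftrightarrow> (\<exists>gs. gale_transform vs gs \<and> D = mset (map sgn gs))"

definition polytope_gale_diagram ::
    "'a::euclidean_space set \<Rightarrow> 'b::euclidean_space multiset \<Rightarrow> bool" where
  "polytope_gale_diagram Q D \<longleftrightarrow>
     (\<exists>vs. distinct vs \<and> set vs = {x. x extreme_point_of Q} \<and> gale_diagram vs D)"

definition proper_face_of :: "'a::euclidean_space set \<Rightarrow> 'a set \<Rightarrow> bool" where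
  "proper_face_of F Q \<longleftrightarrow> F face_of Q \<and> F \<noteq> Q"

definition simplicial_polytope :: "'a::euclidean_space set \<Rightarrow> bool" where
  "simplicial_polytope Q \<longleftrightarrow>
     polytope Q \<and> (\<forall>F. proper_face_of F Q \<longrightarrow> (\<exists>k. k simplex F))"

text \<open>Isomorphism of the posets of all faces, including \<open>{}\<close> and the polytope itself.\<close>

definition combinatorially_equivalent ::
    "'a::euclidean_space set \<Rightarrow> 'b::euclidean_space set \<Rightarrow> bool" where
  "combinatorially_equivalent P Q \<longleftrightarrow>
     (\<exists>\<phi>. bij_betw \<phi> {F. F face_of P} {G. G face_of Q} \<and>
        (\<forall>F F'. F face_of P \<longrightarrow> F' face_of P \<longrightarrow> (F \<subseteq> F' \<longleftrightarrow> \<phi> F \<subseteq> \<phi> F')))"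

text \<open>\<open>pyramid d K T\<close>: \<open>T\<close> is a \<open>d\<close>-pyramid with basis \<open>K\<close>.\<close>

definition pyramid :: "int \<Rightarrow> 'a::euclidean_space set \<Rightarrow> 'a set \<Rightarrow> bool" where
  "pyramid d K T \<longleftrightarrow>
     polytope K \<and> aff_dim K = d - 1 \<and>
     (\<exists>a. a \<notin> affine hull K \<and> T = convex hull (insert a K))"

text \<open>\<open>fold_pyramid r d K T\<close>: \<open>T\<close> is an \<open>r\<close>-fold \<open>d\<close>-pyramid with basis \<open>K\<close>.\<close>

primrec fold_pyramid :: "nat \<Rightarrow> int \<Rightarrow> 'a::euclidean_space set \<Rightarrow> 'a set \<Rightarrow> bool" where
  "fold_pyramid 0 d K T \<longleftrightarrow> polytope K \<and> aff_dim K = d \<and> T = K"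
| "fold_pyramid (Suc r) d K T \<longleftrightarrow> (\<exists>B. fold_pyramid r (d - 1) K B \<and> pyramid d B T)"

text \<open>Since \<open>d\<close> is a variable, and pyramids over a cyclic polytope leave \<open>\<real>\<^sup>d\<close>, the space \<open>\<real>\<^sup>d\<close>
  containing the moment curve \<open>t \<mapsto> (t, t\<^sup>2, \<dots>, t\<^sup>d)\<close> is taken to be the coordinate subspace of
  the ambient space spanned by \<open>d\<close> distinct standard basis vectors \<open>e 1, \<dots>, e d\<close>.\<close>

definition cyclic_polytope :: "nat \<Rightarrow> nat \<Rightarrow> 'a::euclidean_space set \<Rightarrow> bool" where
  "cyclic_polytope v d K \<longleftrightarrow>
     (\<exists>e ts. inj_on e {1..d} \<and> e ` {1..d} \<subseteq> Basis \<and>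
        finite ts \<and> card ts = v \<and> v > d \<and>
        K = convex hull ((\<lambda>t::real. \<Sum>i=1..d. t ^ i *\<^sub>R e i) ` ts))"

end

theory Submission
  imports Defs "HOL-Computational_Algebra.Polynomial"
begin

text \<open>Write \<open>\<xi>\<close> for the map sending a face to its incidence vector. Everything rests on one fact:
  up to a factor, the vectors \<open>\<xi> f\<close> satisfy a single affine relation,
  \<open>\<Sum>\<^bsub>f \<in> color 2\<^esub> \<xi> f = \<Sum>\<^bsub>f \<in> color 1\<^esub> \<xi> f\<close>. It is a relation because the three faces at a vertex of \<open>P\<close>
  carry the three colors, so each color class sums to the all-ones vector. Conversely, a linear
  relation \<open>z\<close> gives \<open>z f + z g + z h = 0\<close> for the three faces at each vertex. The two ends of an edge
  share two faces, so the values of \<open>z\<close> on the third faces, which have equal color, agree as well;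
  since the edge graph is connected, \<open>z\<close> depends on the color only
  (\<open>relation_constant_on_colors\<close>). The condition that the coefficients sum to zero, together with
  \<open>m 1 = m 2 \<noteq> m 3\<close>, then kills the value on color 3.

  A finite set with one affine relation \<open>lam\<close> is treated in the locale \<open>affine_circuit\<close>. There
  \<open>lam\<close> itself is the Gale transform, with values in \<open>\<real>\<close>, and Gale duality becomes concrete: the hull
  of a subset \<open>J\<close> is a face iff \<open>J\<close> contains all points of positive coefficient exactly when it
  contains all points of negative coefficient (\<open>face_iff_balanced\<close>). Applied to the incidence
  vectors this is the list of faces; the hull of the first two color classes is a proper face with
  affinely dependent vertices, so the polytope is not simplicial. Moreover the numbers of positive,
  negative and zero coefficients determine the face lattice (\<open>circuits_same_counts_equivalent\<close>).

  The points \<open>0, \<dots>, d + 1\<close> on the moment curve in dimension \<open>d\<close> also satisfy a single relation, whose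
  signs alternate. Adding \<open>r\<close> further basis vectors adds \<open>r\<close> zero coefficients and turns the cyclic
  polytope into an \<open>r\<close>-fold pyramid. For \<open>d = 2 * m 2 - 2\<close> and \<open>r = m 3\<close> the sign counts agree with
  those of the incidence vectors.

  That this pyramid has dimension \<open>n\<close> is the identity \<open>m 1 + m 2 + m 3 = n + 2\<close>, Euler's formula for a
  simple 3-polytope. It follows from a generic linear functional: counting the lowest and the
  highest vertex of every facet counts each facet twice, whereas a vertex with \<open>k\<close> ascending edges is
  lowest or highest in \<open>3, 1, 1, 3\<close> of its facets for \<open>k = 0, 1, 2, 3\<close>, and the value 3 occurs only
  at the two extremes of the polytope. Both this count and the connectedness of the edge graph use
  that a simple polytope lies in the cone spanned by the edges at any of its vertices
  (\<open>simple_vertex_cone\<close>).\<close>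

section \<open>Edges at a vertex of a simple 3-polytope\<close>

definition facets_at :: "'a::euclidean_space set \<Rightarrow> 'a \<Rightarrow> 'a set set" where
  "facets_at P v = {f \<in> two_faces P. v \<in> f}"

lemma two_faces_eq_facets:
  assumes "simple_3_polytope P"
  shows "two_faces P = {f. f facet_of P}"
  using assms by (auto simp: two_faces_def simple_3_polytope_def facet_of_def)

lemma simple_3_polytopeD:
  assumes "simple_3_polytope P"
  shows "polytope P" "aff_dim P = 3" "v extreme_point_of P \<Longrightarrow> card (facets_at P v) = 3"
  using assms by (auto simp: simple_3_polytope_def facets_at_def)

lemma finite_two_faces:
  fixes P :: "'a::euclidean_space set"
  shows "polytope P \<Longrightarrow> finite (two_faces P)"
  unfolding two_faces_def using finite_polytope_faces[of P] by (rule rev_finite_subset) auto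

lemma finite_vertices:
  fixes P :: "'a::euclidean_space set"
  shows "polytope P \<Longrightarrow> finite {v. v extreme_point_of P}"
  by (rule finite_polyhedron_extreme_points[OF polytope_imp_polyhedron])

lemma polytope_eq_hull_vertices:
  fixes P :: "'a::euclidean_space set"
  assumes "polytope P" "f face_of P"
  shows "f = convex hull {v. v extreme_point_of P \<and> v \<in> f}"
proof -
  have "polytope f"
    using assms face_of_polytope_polytope by blast
  then have "f = convex hull {v. v extreme_point_of f}"
    by (simp add: Krein_Milman_Minkowski polytope_imp_compact polytope_imp_convex)
  then show ?thesis
    using extreme_point_of_face[OF assms(2)] by simp
qed

text \<open>A ridge, like every proper face, is determined by the facets above it; this allows edges to be
  identified by counting facets.\<close>

lemma ridge_eq_Inter_facets:
  assumes P: "polyhedron P" and g: "g facet_of P" and e: "e facet_of g" "e \<noteq> {}"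
  shows "e = \<Inter>{f. f facet_of P \<and> e \<subseteq> f}"
proof -
  have "e face_of P"
    using e g face_of_trans facet_of_imp_face_of by blast
  moreover have "e \<noteq> P"
    using e g by (auto simp: facet_of_def)
  ultimately show ?thesis
    using face_of_polyhedron[OF P] e by blast
qed

lemma Inter_facets_at:
  assumes P: "simple_3_polytope P" and v: "v extreme_point_of P"
  shows "\<Inter>(facets_at P v) = {v}"
proof -
  have "facets_at P v = {f. f facet_of P \<and> {v} \<subseteq> f}"
    by (auto simp: facets_at_def two_faces_eq_facets[OF P])
  then show ?thesis
    using face_of_polyhedron[of P "{v}"] v polytope_imp_polyhedron
      simple_3_polytopeD(1,2)[OF P] face_of_singleton by force
qed

text \<open>Choose a second facet \<open>g\<close> at \<open>v\<close>. An edge of \<open>g\<close> through \<open>v\<close> is an intersection of facets of \<open>P\<close> at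
  \<open>v\<close>, but neither of all three, which meet in \<open>v\<close> only, nor of \<open>g\<close> alone; hence it is \<open>g\<close> intersected
  with one other facet. The edges of \<open>g\<close> at \<open>v\<close> meet in the point \<open>v\<close>, so a single one does not
  suffice and both intersections are edges.\<close>

lemma simple_vertex_edge:
  assumes P: "simple_3_polytope P" and v: "v extreme_point_of P" and f: "f \<in> facets_at P v"
  shows "\<Inter>(facets_at P v - {f}) edge_of P"
proof -
  let ?F = "facets_at P v"
  note PD = simple_3_polytopeD[OF P]
  have poly: "polyhedron P"
    using PD polytope_imp_polyhedron by blast
  have vface: "{v} face_of P"
    using v by (simp add: face_of_singleton)
  have F_eq: "?F = {f. f facet_of P \<and> {v} \<subseteq> f}"
    by (auto simp: facets_at_def two_faces_eq_facets[OF P])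
  note meet = Inter_facets_at[OF P v]
  obtain g h where fgh: "?F = {f, g, h}" "f \<noteq> g" "f \<noteq> h" "g \<noteq> h"
  proof -
    have "card (?F - {f}) = 2"
      using PD(3)[OF v] f by (simp add: card_Diff_singleton)
    then obtain g h where "?F - {f} = {g, h}" "g \<noteq> h"
      by (auto simp: card_2_iff)
    then show ?thesis
      using that[of g h] f by blast
  qed
  have g: "g facet_of P" "v \<in> g"
    using fgh F_eq by auto
  have dim_g: "aff_dim g = 2"
    using g PD(2) by (simp add: facet_of_def)
  have poly_g: "polyhedron g"
    using g poly face_of_polyhedron_polyhedron facet_of_imp_face_of by blast
  have v_g: "{v} face_of g"
    using g vface by (meson empty_subsetI face_of_face facet_of_imp_face_of insert_subset)
  let ?E = "{e. e facet_of g \<and> {v} \<subseteq> e}"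
  have meet_E: "{v} = \<Inter>?E"
    using face_of_polyhedron[OF poly_g v_g] dim_g by force
  have cases_E: "e = g \<inter> f \<or> e = g \<inter> h" if "e \<in> ?E" for e
  proof -
    have e: "e facet_of g" "v \<in> e" "aff_dim e = 1"
      using that dim_g by (auto simp: facet_of_def)
    define X where "X = {f. f facet_of P \<and> e \<subseteq> f}"
    have eX: "e = \<Inter>X"
      unfolding X_def by (rule ridge_eq_Inter_facets[OF poly g(1) e(1)]) (use e in auto)
    have "X \<subseteq> ?F" "g \<in> X"
      using e g by (auto simp: X_def F_eq facet_of_def face_of_imp_subset)
    moreover have "X \<noteq> ?F"
      using eX meet e(3) by auto
    moreover have "X \<noteq> {g}"
      using eX dim_g e(3) by auto
    ultimately have "X = {g,f} \<or> X = {g,h}"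
      unfolding fgh by auto
    then show ?thesis
      using eX by auto
  qed
  have "g \<inter> h \<in> ?E"
  proof (rule ccontr)
    assume "g \<inter> h \<notin> ?E"
    then have "?E \<subseteq> {g \<inter> f}"
      using cases_E by blast
    then have "?E = {} \<or> ?E = {g \<inter> f}"
      by blast
    then show False
    proof
      assume "?E = {}"
      then have "{v} = (UNIV :: 'a set)"
        using meet_E by (metis Inter_empty)
      then have "aff_dim P \<le> 0"
        using aff_dim_subset[of P "{v}"] by (metis aff_dim_sing subset_UNIV)
      then show False using PD(2) by simp
    next
      \<comment> \<open>The one edge would be \<open>{v}\<close>, which has the wrong dimension.\<close>
    assume E: "?E = {g \<inter> f}"
      then have "{v} = g \<inter> f"
        using meet_E by simp
      moreover have "aff_dim (g \<inter> f) = 1"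
        using E dim_g unfolding facet_of_def by auto
      ultimately show False
        by (metis aff_dim_sing zero_neq_one)
    qed
  qed
  then have "(g \<inter> h) face_of P" "aff_dim (g \<inter> h) = 1"
    using g dim_g by (auto simp: facet_of_def intro: face_of_trans)
  moreover have "\<Inter>(?F - {f}) = g \<inter> h"
    unfolding fgh using fgh(2,3) by auto
  ultimately show ?thesis
    by (simp add: edge_of_def)
qed

text \<open>The point \<open>w f\<close> is the far end of the edge at \<open>v\<close> that leaves the facet \<open>f\<close>. Indexing the edges at
  \<open>v\<close> by the facets opposite to them records all incidences between neighbours and facets at once.\<close>

lemma simple_vertex_neighbours:
  assumes P: "simple_3_polytope P" and v: "v extreme_point_of P"
  obtains w where
    "\<And>f. f \<in> facets_at P v \<Longrightarrow> w f extreme_point_of P"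
    "\<And>f g. f \<in> facets_at P v \<Longrightarrow> g \<in> facets_at P v \<Longrightarrow> w f \<in> g \<longleftrightarrow> g \<noteq> f"
proof -
  let ?F = "facets_at P v"
  have poly: "polytope P"
    using simple_3_polytopeD[OF P] by blast
  note meet = Inter_facets_at[OF P v]
  have "\<exists>w. w extreme_point_of P \<and> (\<forall>g\<in>?F. w \<in> g \<longleftrightarrow> g \<noteq> f)" if f: "f \<in> ?F" for f
  proof -
    let ?e = "\<Inter>(?F - {f})"
    have e: "?e face_of P" "aff_dim ?e = 1"
      using simple_vertex_edge[OF P v f] by (auto simp: edge_of_def)
    let ?X = "{w. w extreme_point_of P \<and> w \<in> ?e}"
    have eX: "?e = convex hull ?X"
      by (rule polytope_eq_hull_vertices[OF poly e(1)])
    have "\<not> ?X \<subseteq> {v}"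
    proof
      assume "?X \<subseteq> {v}"
      then have "?e \<subseteq> {v}"
        using eX hull_mono[of ?X "{v}" convex] by (metis convex_hull_singleton)
      then show False
        using e(2) aff_dim_subset[of ?e "{v}"] by simp
    qed
    then obtain w where w: "w extreme_point_of P" "w \<in> ?e" "w \<noteq> v"
      by auto
    then have "w \<notin> f"
      using meet f by blast
    then show ?thesis
      using w f by blast
  qed
  then show ?thesis
    using that by metis
qed

text \<open>The normals of the facets at \<open>v\<close> are, up to negative factors, dual to the edge directions
  \<open>w f - v\<close>. Hence the three directions are independent and span the direction space of \<open>P\<close>, and the
  facet inequality for \<open>f\<close> says that the coefficient of \<open>w f - v\<close> is nonnegative.\<close>

lemma simple_vertex_cone:
  assumes P: "simple_3_polytope P" and v: "v extreme_point_of P"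
    and w: "\<And>f. f \<in> facets_at P v \<Longrightarrow> w f \<in> P"
      "\<And>f g. f \<in> facets_at P v \<Longrightarrow> g \<in> facets_at P v \<Longrightarrow> w f \<in> g \<longleftrightarrow> g \<noteq> f"
    and x: "x \<in> P"
  obtains t where "x - v = (\<Sum>f\<in>facets_at P v. t f *\<^sub>R (w f - v))"
    "\<And>f. f \<in> facets_at P v \<Longrightarrow> t f \<ge> 0"
    "\<And>f. f \<in> facets_at P v \<Longrightarrow> x \<in> f \<Longrightarrow> t f = 0"
proof -
  let ?F = "facets_at P v"
  let ?d = "\<lambda>f. w f - v"
  note PD = simple_3_polytopeD[OF P]
  have finF: "finite ?F" and cardF: "card ?F = 3"
    using PD(3)[OF v] card_ge_0_finite[of ?F] by simp_all
  have vP: "v \<in> P"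
    using v by (simp add: extreme_point_of_def)
  have "\<exists>a. \<exists>b. P \<subseteq> {x. a \<bullet> x \<le> b} \<and> f = P \<inter> {x. a \<bullet> x = b}" if "f \<in> ?F" for f
  proof -
    have "f facet_of P"
      using that by (simp add: facets_at_def two_faces_eq_facets[OF P])
    then obtain a b where "P \<subseteq> {x. a \<bullet> x \<le> b}" "f = P \<inter> {x. a \<bullet> x = b}"
      using facet_of_polyhedron[of P f] PD(1) polytope_imp_polyhedron by blast
    then show ?thesis by blast
  qed
  then obtain a b where ab: "\<And>f. f \<in> ?F \<Longrightarrow> P \<subseteq> {x. a f \<bullet> x \<le> b f}"
      "\<And>f. f \<in> ?F \<Longrightarrow> f = P \<inter> {x. a f \<bullet> x = b f}"
    by metis
  have av: "a f \<bullet> v = b f" if "f \<in> ?F" for f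
    using ab(2)[OF that] that by (auto simp: facets_at_def)
  have ad0: "a g \<bullet> ?d f = 0" if "f \<in> ?F" "g \<in> ?F" "g \<noteq> f" for f g
    using ab(2)[of g] w(2)[of f g] that av[of g] by (auto simp: inner_diff_right)
  have adneg: "a f \<bullet> ?d f < 0" if "f \<in> ?F" for f
  proof -
    have "w f \<notin> f" using w(2) that by blast
    then have "a f \<bullet> w f \<noteq> b f"
      using ab(2)[OF that] w(1)[OF that] by blast
    moreover have "a f \<bullet> w f \<le> b f"
      using ab(1) w(1) that by blast
    ultimately show ?thesis
      using av[OF that] by (simp add: inner_diff_right)
  qed
  have inner_sum: "a g \<bullet> (\<Sum>f\<in>?F. t f *\<^sub>R ?d f) = t g * (a g \<bullet> ?d g)" if g: "g \<in> ?F" for t g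
  proof -
    have "a g \<bullet> (\<Sum>f\<in>?F. t f *\<^sub>R ?d f) = (\<Sum>f\<in>?F. if f = g then t g * (a g \<bullet> ?d g) else 0)"
      unfolding inner_sum_right by (intro sum.cong) (use g ad0 in auto)
    then show ?thesis
      using g finF by simp
  qed
  have inj: "inj_on ?d ?F"
    by (rule inj_onI) (metis ad0 adneg less_irrefl)
  have indep: "independent (?d ` ?F)"
  proof (rule independent_if_scalars_zero)
    show "finite (?d ` ?F)" using finF by simp
    fix u y
    assume u: "(\<Sum>y\<in>?d ` ?F. u y *\<^sub>R y) = 0" and "y \<in> ?d ` ?F"
    then obtain g where g: "g \<in> ?F" "y = ?d g" by auto
    have "(\<Sum>f\<in>?F. u (?d f) *\<^sub>R ?d f) = 0"
      using u by (simp add: sum.reindex[OF inj])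
    then have "u (?d g) * (a g \<bullet> ?d g) = 0"
      using inner_sum[OF g(1), of "\<lambda>f. u (?d f)"] by simp
    then show "u y = 0"
      using adneg[OF g(1)] g by auto
  qed
  let ?L = "(\<lambda>x. x - v) ` P"
  have "int (dim ?L) = 3"
    using aff_dim_eq_dim_subtract[of v P] PD(2) vP by (simp add: hull_inc)
  then have "?L \<subseteq> span (?d ` ?F)"
    using card_ge_dim_independent[of "?d ` ?F" ?L] indep w(1) card_image[OF inj] cardF by auto
  then have "x - v \<in> span (?d ` ?F)"
    using x by blast
  then obtain u where u: "x - v = (\<Sum>y\<in>?d ` ?F. u y *\<^sub>R y)"
    using finF by (auto simp: span_finite)
  define t where "t f = u (?d f)" for f
  have t: "x - v = (\<Sum>f\<in>?F. t f *\<^sub>R ?d f)"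
    using u by (simp add: sum.reindex[OF inj] t_def)
  have eq: "a f \<bullet> x - b f = t f * (a f \<bullet> ?d f)" if "f \<in> ?F" for f
    using inner_sum[OF that, of t] t av[OF that] by (metis inner_diff_right)
  show ?thesis
  proof (rule that[OF t])
    fix f assume f: "f \<in> ?F"
    have "a f \<bullet> x \<le> b f" using ab(1)[OF f] x by blast
    then have "t f * (a f \<bullet> ?d f) \<le> 0" using eq[OF f] by simp
    then show "t f \<ge> 0"
      using adneg[OF f] by (meson mult_neg_neg not_le)
  next
    fix f assume f: "f \<in> ?F" "x \<in> f"
    then have "a f \<bullet> x = b f" using ab(2)[OF f(1)] by blast
    then show "t f = 0"
      using eq[OF f(1)] adneg[OF f(1)] by simp
  qed
qed

section \<open>Counting facets with a generic linear functional\<close>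

text \<open>The functionals identifying two given distinct points form a hyperplane, and finitely many
  hyperplanes do not cover the space.\<close>

lemma exists_injective_functional:
  fixes X :: "'a::euclidean_space set"
  assumes "finite X"
  obtains u where "inj_on (\<lambda>x. u \<bullet> x) X"
proof -
  let ?H = "\<lambda>p. {u. (fst p - snd p) \<bullet> u = 0}"
  let ?N = "\<Union>p\<in>X \<times> X - Id. ?H p"
  have "negligible ?N"
  proof (rule negligible_Union)
    show "finite (?H ` (X \<times> X - Id))" using assms by simp
    show "negligible T" if "T \<in> ?H ` (X \<times> X - Id)" for T
      using that by (auto intro: negligible_hyperplane)
  qed
  then have "?N \<noteq> UNIV" by (metis non_negligible_UNIV)
  then obtain u where "u \<notin> ?N" by blast
  have "inj_on (\<lambda>x. u \<bullet> x) X"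
  proof (rule inj_onI, rule ccontr)
    fix x y assume "x \<in> X" "y \<in> X" "u \<bullet> x = u \<bullet> y" "x \<noteq> y"
    then have "(x, y) \<in> X \<times> X - Id" "u \<in> ?H (x, y)"
      by (auto simp: inner_diff_left inner_commute[of _ u])
    then show False using \<open>u \<notin> ?N\<close> by blast
  qed
  then show ?thesis using that by blast
qed

lemma card_filter_eq_sum:
  assumes "finite A"
  shows "card {x \<in> A. Q x} = (\<Sum>x\<in>A. of_bool (Q x))"
  using assms by (simp add: sum_of_bool_eq Int_def)

lemma card_eq_1_if_ex1: "\<exists>!x. x \<in> A \<Longrightarrow> card A = 1"
  by (metis card_1_singleton_iff One_nat_def empty_iff insert_iff subsetI subset_antisym)

definition vertices_in :: "'a::euclidean_space set \<Rightarrow> 'a set \<Rightarrow> 'a set" where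
  "vertices_in P A = {v. v extreme_point_of P \<and> v \<in> A}"

definition lowest :: "'a::euclidean_space \<Rightarrow> 'a set \<Rightarrow> 'a \<Rightarrow> bool" where
  "lowest u X v \<longleftrightarrow> v \<in> X \<and> (\<forall>x\<in>X. u \<bullet> v \<le> u \<bullet> x)"

lemma finite_vertices_in: "polytope P \<Longrightarrow> finite (vertices_in P A)"
  unfolding vertices_in_def by (rule finite_subset[OF _ finite_vertices[of P]]) auto

lemma vertices_in_face_nonempty:
  assumes "polytope P" "f face_of P" "f \<noteq> {}"
  shows "vertices_in P f \<noteq> {}"
  using polytope_eq_hull_vertices[OF assms(1,2)] assms(3)
  unfolding vertices_in_def by (metis convex_hull_empty)

lemma ex1_lowest:
  assumes "finite X" "X \<noteq> {}" "inj_on (\<lambda>x. u \<bullet> x) X"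
  shows "\<exists>!v. lowest u X v"
proof -
  obtain v where v: "v \<in> X" "u \<bullet> v = Min ((\<lambda>x. u \<bullet> x) ` X)"
    using Min_in[of "(\<lambda>x. u \<bullet> x) ` X"] assms(1,2) by (metis (no_types) finite_imageI image_iff image_is_empty)
  then have "lowest u X v"
    using assms(1) by (auto simp: lowest_def)
  moreover have "w = v" if "lowest u X w" for w
    using that v \<open>lowest u X v\<close> assms(3) by (meson inj_onD lowest_def order_antisym)
  ultimately show ?thesis by blast
qed

text \<open>The optimality criterion of the simplex method: by the cone description, a functional that
  increases along every edge at \<open>v\<close> is minimal at \<open>v\<close>. A facet \<open>f\<close> at \<open>v\<close> lies in the cone spanned by
  the edges opposite to the other facets.\<close>

lemma lowest_iff_edges_ascend:
  assumes P: "simple_3_polytope P" and v: "v extreme_point_of P"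
    and inj: "inj_on (\<lambda>x. u \<bullet> x) (vertices_in P P)"
    and w: "\<And>f. f \<in> facets_at P v \<Longrightarrow> w f extreme_point_of P"
      "\<And>f g. f \<in> facets_at P v \<Longrightarrow> g \<in> facets_at P v \<Longrightarrow> w f \<in> g \<longleftrightarrow> g \<noteq> f"
  shows "lowest u (vertices_in P P) v \<longleftrightarrow> (\<forall>g\<in>facets_at P v. u \<bullet> v < u \<bullet> w g)"
    and "f \<in> facets_at P v \<Longrightarrow>
      lowest u (vertices_in P f) v \<longleftrightarrow> (\<forall>g\<in>facets_at P v - {f}. u \<bullet> v < u \<bullet> w g)"
proof -
  let ?F = "facets_at P v"
  have ext: "x \<in> P" if "x extreme_point_of P" for x
    using that by (simp add: extreme_point_of_def)
  have vF: "v \<in> f" if "f \<in> ?F" for f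
    using that by (simp add: facets_at_def)
  have less: "u \<bullet> v < u \<bullet> w g" if g: "g \<in> ?F" and "u \<bullet> v \<le> u \<bullet> w g" for g
  proof -
    have "w g \<noteq> v" using w(2)[OF g g] vF[OF g] by blast
    then have "u \<bullet> v \<noteq> u \<bullet> w g"
      using inj_onD[OF inj, of v "w g"] ext v w(1)[OF g] by (auto simp: vertices_in_def)
    then show ?thesis using that by simp
  qed
  have ge: "u \<bullet> v \<le> u \<bullet> x" if x: "x \<in> P" and up: "\<And>g. g \<in> ?F \<Longrightarrow> x \<in> g \<or> u \<bullet> v < u \<bullet> w g" for x
  proof -
    obtain t where t: "x - v = (\<Sum>f\<in>?F. t f *\<^sub>R (w f - v))"
      "\<And>f. f \<in> ?F \<Longrightarrow> t f \<ge> 0" "\<And>f. f \<in> ?F \<Longrightarrow> x \<in> f \<Longrightarrow> t f = 0"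
      using simple_vertex_cone[OF P v _ w(2) x] w(1) ext by blast
    have "0 \<le> (\<Sum>f\<in>?F. t f * (u \<bullet> w f - u \<bullet> v))"
    proof (rule sum_nonneg)
      fix f assume "f \<in> ?F"
      then show "0 \<le> t f * (u \<bullet> w f - u \<bullet> v)"
        using t(2,3)[of f] up[of f] by (cases "x \<in> f") auto
    qed
    also have "\<dots> = u \<bullet> (x - v)"
      unfolding t(1) by (simp add: inner_sum_right inner_diff_right)
    finally show ?thesis by (simp add: inner_diff_right)
  qed
  show "lowest u (vertices_in P P) v \<longleftrightarrow> (\<forall>g\<in>?F. u \<bullet> v < u \<bullet> w g)"
    using v ext w(1) less ge by (auto simp: lowest_def vertices_in_def)
  show "lowest u (vertices_in P f) v \<longleftrightarrow> (\<forall>g\<in>?F - {f}. u \<bullet> v < u \<bullet> w g)" if f: "f \<in> ?F"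
  proof
    assume low: "lowest u (vertices_in P f) v"
    show "\<forall>g\<in>?F - {f}. u \<bullet> v < u \<bullet> w g"
    proof
      fix g assume g: "g \<in> ?F - {f}"
      then have "w g \<in> vertices_in P f"
        using w f by (auto simp: vertices_in_def)
      then show "u \<bullet> v < u \<bullet> w g"
        using less g low by (auto simp: lowest_def)
    qed
  next
    assume up: "\<forall>g\<in>?F - {f}. u \<bullet> v < u \<bullet> w g"
    then show "lowest u (vertices_in P f) v"
      using v vF[OF f] ext ge by (auto simp: lowest_def vertices_in_def)
  qed
qed

text \<open>If \<open>k\<close> of the three edges ascend, then \<open>v\<close> is lowest in \<open>k choose 2\<close> facets and highest in
  \<open>(3 - k) choose 2\<close>, which add up to \<open>3, 1, 1, 3\<close>.\<close>

lemma local_extremum_count: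
  assumes P: "simple_3_polytope P" and v: "v extreme_point_of P"
    and inj: "inj_on (\<lambda>x. u \<bullet> x) (vertices_in P P)"
  shows "card {f \<in> facets_at P v. lowest u (vertices_in P f) v}
      + card {f \<in> facets_at P v. lowest (- u) (vertices_in P f) v}
    = 1 + 2 * of_bool (lowest u (vertices_in P P) v) + 2 * of_bool (lowest (- u) (vertices_in P P) v)"
proof -
  obtain w where w: "\<And>f. f \<in> facets_at P v \<Longrightarrow> w f extreme_point_of P"
    "\<And>f g. f \<in> facets_at P v \<Longrightarrow> g \<in> facets_at P v \<Longrightarrow> w f \<in> g \<longleftrightarrow> g \<noteq> f"
    using simple_vertex_neighbours[OF P v] by blast
  have inj': "inj_on (\<lambda>x. (- u) \<bullet> x) (vertices_in P P)"
    using inj by (simp add: inj_on_def)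
  note low = lowest_iff_edges_ascend[OF P v inj w]
  note low' = lowest_iff_edges_ascend[OF P v inj' w]
  obtain f g h where F: "facets_at P v = {f, g, h}" "f \<noteq> g" "f \<noteq> h" "g \<noteq> h"
    using simple_3_polytopeD(3)[OF P v] by (auto simp: card_3_iff)
  have ne: "u \<bullet> v \<noteq> u \<bullet> w k" if "k \<in> {f, g, h}" for k
  proof -
    have k: "k \<in> facets_at P v" using that F by simp
    then have "w k \<noteq> v" using w(2)[OF k k] by (auto simp: facets_at_def)
    then show ?thesis
      using inj_onD[OF inj, of v "w k"] v w(1)[OF k] by (auto simp: vertices_in_def extreme_point_of_def)
  qed
  have card3: "card {k \<in> {f, g, h}. Q k} = of_bool (Q f) + of_bool (Q g) + of_bool (Q h)" for Q
  proof -
    have "card {k \<in> {f, g, h}. Q k} = (\<Sum>k\<in>{f, g, h}. of_bool (Q k))"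
      by (rule card_filter_eq_sum) simp
    then show ?thesis using F by simp
  qed
  have sides: "- u \<bullet> v < - u \<bullet> w k \<longleftrightarrow> \<not> u \<bullet> v < u \<bullet> w k" if "k \<in> {f, g, h}" for k
    using ne[OF that] by auto
  have minus: "{f, g, h} - {f} = {g, h}" "{f, g, h} - {g} = {f, h}" "{f, g, h} - {h} = {f, g}"
    using F(2-4) by auto
  let ?U = "\<lambda>k. u \<bullet> v < u \<bullet> w k"
  have lowest_eqs: "lowest u (vertices_in P f) v \<longleftrightarrow> ?U g \<and> ?U h"
    "lowest u (vertices_in P g) v \<longleftrightarrow> ?U f \<and> ?U h"
    "lowest u (vertices_in P h) v \<longleftrightarrow> ?U f \<and> ?U g"
    "lowest u (vertices_in P P) v \<longleftrightarrow> ?U f \<and> ?U g \<and> ?U h"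
    using low(1) low(2)[of f] low(2)[of g] low(2)[of h] unfolding F(1) minus by simp_all
  have highest_eqs: "lowest (- u) (vertices_in P f) v \<longleftrightarrow> \<not> ?U g \<and> \<not> ?U h"
    "lowest (- u) (vertices_in P g) v \<longleftrightarrow> \<not> ?U f \<and> \<not> ?U h"
    "lowest (- u) (vertices_in P h) v \<longleftrightarrow> \<not> ?U f \<and> \<not> ?U g"
    "lowest (- u) (vertices_in P P) v \<longleftrightarrow> \<not> ?U f \<and> \<not> ?U g \<and> \<not> ?U h"
    using low'(1) low'(2)[of f] low'(2)[of g] low'(2)[of h] sides[of f] sides[of g] sides[of h]
    unfolding F(1) minus by simp_all
  show ?thesis
    unfolding F(1) card3 lowest_eqs highest_eqs
    by (cases "?U f"; cases "?U g"; cases "?U h"; simp)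
qed

lemma sum_card_lowest:
  assumes P: "simple_3_polytope P"
    and inj: "inj_on (\<lambda>x. u \<bullet> x) (vertices_in P P)"
  shows "(\<Sum>v\<in>vertices_in P P. card {f \<in> facets_at P v. lowest u (vertices_in P f) v}) = card (two_faces P)"
proof -
  let ?V = "vertices_in P P" and ?L = "\<lambda>f v. lowest u (vertices_in P f) v"
  have poly: "polytope P" using simple_3_polytopeD[OF P] by blast
  have fin: "finite ?V" "finite (two_faces P)"
    using finite_vertices_in finite_two_faces poly by blast+
  have "card {v \<in> ?V. ?L f v} = 1" if f: "f \<in> two_faces P" for f
  proof -
    have face: "f face_of P" "f \<noteq> {}" "f \<subseteq> P"
      using f by (auto simp: two_faces_def face_of_imp_subset)
    then have sub: "vertices_in P f \<subseteq> ?V" by (auto simp: vertices_in_def)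
    have "\<exists>!v. ?L f v"
      by (rule ex1_lowest[OF finite_vertices_in[OF poly] vertices_in_face_nonempty[OF poly face(1,2)]])
        (rule inj_on_subset[OF inj sub])
    moreover have "?L f v \<Longrightarrow> v \<in> ?V" for v using sub by (auto simp: lowest_def)
    ultimately have "\<exists>!v. v \<in> {v \<in> ?V. ?L f v}" by blast
    then show ?thesis by (rule card_eq_1_if_ex1)
  qed
  then have one: "(\<Sum>v\<in>?V. of_bool (?L f v)) = (1::nat)" if "f \<in> two_faces P" for f
    using that by (simp only: card_filter_eq_sum[OF fin(1), symmetric])
  have "card {f \<in> facets_at P v. ?L f v} = (\<Sum>f\<in>two_faces P. of_bool (?L f v))" for v
  proof -
    have "{f \<in> facets_at P v. ?L f v} = two_faces P \<inter> {f. ?L f v}"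
      by (auto simp: facets_at_def lowest_def vertices_in_def)
    then show ?thesis using fin by (simp add: sum_of_bool_eq)
  qed
  then have "(\<Sum>v\<in>?V. card {f \<in> facets_at P v. ?L f v}) = (\<Sum>v\<in>?V. \<Sum>f\<in>two_faces P. of_bool (?L f v))"
    by simp
  also have "\<dots> = (\<Sum>f\<in>two_faces P. \<Sum>v\<in>?V. of_bool (?L f v))"
    by (rule sum.swap)
  also have "\<dots> = card (two_faces P)"
    using one by simp
  finally show ?thesis .
qed

text \<open>Euler's formula in the simple case, where the number of edges is determined by that of the
  vertices. Each facet has one lowest and one highest vertex, so the sum of the local counts is
  twice the number of facets; it is also one for each vertex, plus two for each of the lowest and
  the highest vertex of \<open>P\<close>.\<close>

theorem simple_3_polytope_facet_count:
  assumes P: "simple_3_polytope P"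
  shows "2 * card (two_faces P) = card {v. v extreme_point_of P} + 4"
proof -
  let ?V = "vertices_in P P"
  have poly: "polytope P" using simple_3_polytopeD[OF P] by blast
  have V: "?V = {v. v extreme_point_of P}"
    by (auto simp: vertices_in_def extreme_point_of_def)
  have fin: "finite ?V" using finite_vertices_in poly by blast
  obtain u where u: "inj_on (\<lambda>x. u \<bullet> x) ?V"
    using exists_injective_functional[OF fin] by blast
  have u': "inj_on (\<lambda>x. (- u) \<bullet> x) ?V"
    using u by (simp add: inj_on_def)
  have "P \<noteq> {}" using simple_3_polytopeD(2)[OF P] by auto
  then have ne: "?V \<noteq> {}"
    using vertices_in_face_nonempty[OF poly face_of_refl[OF polytope_imp_convex[OF poly]]] by blast
  have one: "(\<Sum>v\<in>?V. of_bool (lowest q ?V v)) = (1::nat)" if q: "inj_on (\<lambda>x. q \<bullet> x) ?V" for q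
  proof -
    have "\<exists>!v. v \<in> ?V \<inter> {v. lowest q ?V v}"
      using ex1_lowest[OF fin ne q] by (auto simp: lowest_def)
    then have "card (?V \<inter> {v. lowest q ?V v}) = 1"
      by (rule card_eq_1_if_ex1)
    then show ?thesis using fin by (simp add: sum_of_bool_eq)
  qed
  have "2 * card (two_faces P) = (\<Sum>v\<in>?V. card {f \<in> facets_at P v. lowest u (vertices_in P f) v}
      + card {f \<in> facets_at P v. lowest (- u) (vertices_in P f) v})"
    using sum_card_lowest[OF P u] sum_card_lowest[OF P u'] by (simp add: sum.distrib)
  also have "\<dots> = (\<Sum>v\<in>?V. 1 + 2 * of_bool (lowest u ?V v) + 2 * of_bool (lowest (- u) ?V v))"
    by (intro sum.cong refl local_extremum_count[OF P _ u]) (simp add: V)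
  also have "\<dots> = card ?V + 4"
    by (simp only: sum.distrib sum_distrib_left[symmetric] one[OF u] one[OF u']) simp
  finally show ?thesis by (simp add: V)
qed

section \<open>Relations among the facets of a colored polytope\<close>

text \<open>Any two facets at \<open>v\<close> share the edge opposite to the third, so they are adjacent.\<close>

lemma coloring_bij_at_vertex:
  assumes P: "simple_3_polytope P" and c: "proper_3_coloring P c" and v: "v extreme_point_of P"
  shows "bij_betw c (facets_at P v) {1, 2, 3}"
proof -
  let ?F = "facets_at P v"
  have card: "card ?F = 3" using simple_3_polytopeD(3)[OF P v] .
  have "c f \<noteq> c g" if fg: "f \<in> ?F" "g \<in> ?F" "f \<noteq> g" for f g
  proof -
    have "card (?F - {f, g}) = 1"
      using card fg by (simp add: card_Diff_subset)
    then obtain h where h: "?F - {f, g} = {h}" by (auto simp: card_1_singleton_iff)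
    then have "\<Inter>(?F - {h}) edge_of P"
      using simple_vertex_edge[OF P v, of h] by blast
    moreover have "\<Inter>(?F - {h}) \<subseteq> f \<inter> g" using h fg by blast
    ultimately have "adjacent_facets P f g"
      using fg unfolding adjacent_facets_def facets_at_def by blast
    then show ?thesis using c by (simp add: proper_3_coloring_def)
  qed
  then have inj: "inj_on c ?F" by (auto simp: inj_on_def)
  have sub: "c ` ?F \<subseteq> {1, 2, 3}"
    using c by (auto simp: proper_3_coloring_def facets_at_def)
  have "c ` ?F = {1, 2, 3}"
    by (rule card_subset_eq[OF _ sub]) (simp_all add: card_image[OF inj] card)
  then show ?thesis using inj by (simp add: bij_betw_def)
qed

text \<open>Let \<open>Z v i\<close> be the value of \<open>z\<close> on the facet of color \<open>i\<close> at \<open>v\<close>. Two neighbouring vertices share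
  two facets, and their third values are forced by the vanishing sums, so \<open>Z\<close> does not change along
  an edge. Ascending with respect to a generic functional connects every vertex to the highest one.\<close>

lemma relation_constant_on_colors:
  fixes z :: "'a::euclidean_space set \<Rightarrow> real"
  assumes P: "simple_3_polytope P" and c: "proper_3_coloring P c"
    and z: "\<And>v. v extreme_point_of P \<Longrightarrow> (\<Sum>f\<in>facets_at P v. z f) = 0"
  obtains a where "\<And>f. f \<in> two_faces P \<Longrightarrow> z f = a (c f)" "a 1 + a 2 + a (3::nat) = 0"
proof -
  let ?V = "vertices_in P P"
  have poly: "polytope P" using simple_3_polytopeD[OF P] by blast
  have V: "v \<in> ?V \<longleftrightarrow> v extreme_point_of P" for v
    by (auto simp: vertices_in_def extreme_point_of_def)
  have fin: "finite ?V" using finite_vertices_in poly by blast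
  have "P \<noteq> {}" using simple_3_polytopeD(2)[OF P] by auto
  then have ne: "?V \<noteq> {}"
    using vertices_in_face_nonempty[OF poly face_of_refl[OF polytope_imp_convex[OF poly]]] by blast
  obtain u where u: "inj_on (\<lambda>x. u \<bullet> x) ?V"
    using exists_injective_functional[OF fin] by blast
  have u': "inj_on (\<lambda>x. (- u) \<bullet> x) ?V"
    using u by (simp add: inj_on_def)
  define Z where "Z v i = z (inv_into (facets_at P v) c i)" for v i
  have Z: "Z v (c f) = z f" if "v extreme_point_of P" "f \<in> facets_at P v" for v f
    using coloring_bij_at_vertex[OF P c that(1)] that(2)
    by (simp add: Z_def bij_betw_inv_into_left)
  have sumZ: "Z v 1 + Z v 2 + Z v 3 = 0" if v: "v extreme_point_of P" for v
  proof -
    have "(\<Sum>i\<in>{1, 2, 3}. Z v i) = (\<Sum>f\<in>facets_at P v. Z v (c f))"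
      using sum.reindex_bij_betw[OF coloring_bij_at_vertex[OF P c v], of "Z v"] by simp
    also have "\<dots> = 0" using z[OF v] Z[OF v] by simp
    finally show ?thesis by (simp add: add.assoc)
  qed
  have step: "\<exists>w. w extreme_point_of P \<and> u \<bullet> v < u \<bullet> w \<and> (\<forall>i\<in>{1, 2, 3}. Z v i = Z w i)"
    if v: "v extreme_point_of P" and notlow: "\<not> lowest (- u) ?V v" for v
  proof -
    obtain w where w: "\<And>f. f \<in> facets_at P v \<Longrightarrow> w f extreme_point_of P"
      "\<And>f g. f \<in> facets_at P v \<Longrightarrow> g \<in> facets_at P v \<Longrightarrow> w f \<in> g \<longleftrightarrow> g \<noteq> f"
      using simple_vertex_neighbours[OF P v] by blast
    obtain f where f: "f \<in> facets_at P v" "\<not> - u \<bullet> v < - u \<bullet> w f"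
      using lowest_iff_edges_ascend(1)[OF P v u' w] notlow by blast
    have "w f \<noteq> v" using w(2)[OF f(1) f(1)] f(1) by (auto simp: facets_at_def)
    then have "u \<bullet> v \<noteq> u \<bullet> w f"
      using inj_onD[OF u, of v "w f"] V v w(1)[OF f(1)] by blast
    then have up: "u \<bullet> v < u \<bullet> w f" using f by simp
    have same: "Z v (c g) = Z (w f) (c g)" if g: "g \<in> facets_at P v" "g \<noteq> f" for g
    proof -
      have "g \<in> facets_at P (w f)"
        using w(2)[OF f(1) g(1)] g by (auto simp: facets_at_def)
      then show ?thesis using Z[OF v g(1)] Z[OF w(1)[OF f(1)]] by simp
    qed
    have same': "Z v i = Z (w f) i" if i: "i \<in> {1, 2, 3}" "i \<noteq> c f" for i
    proof -
      obtain g where "g \<in> facets_at P v" "i = c g"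
        using coloring_bij_at_vertex[OF P c v] i(1) unfolding bij_betw_def by blast
      then show ?thesis using same i(2) by blast
    qed
    have cf: "c f \<in> {1, 2, 3}"
      using coloring_bij_at_vertex[OF P c v] f(1) unfolding bij_betw_def by blast
    have "\<forall>i\<in>{1, 2, 3}. Z v i = Z (w f) i"
      using cf same'[of 1] same'[of 2] same'[of 3] sumZ[OF v] sumZ[OF w(1)[OF f(1)]] by auto
    then show ?thesis using w(1) f(1) up by blast
  qed
  obtain top where top: "lowest (- u) ?V top" "\<And>v. lowest (- u) ?V v \<Longrightarrow> v = top"
    using ex1_lowest[OF fin ne u'] by blast
  have const: "\<forall>i\<in>{1, 2, 3}. Z v i = Z top i" if "v extreme_point_of P" for v
    using that
  proof (induction "card {x \<in> ?V. u \<bullet> v < u \<bullet> x}" arbitrary: v rule: less_induct)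
    case less
    show ?case
    proof (cases "lowest (- u) ?V v")
      case True
      then show ?thesis using top(2) by blast
    next
      case False
      then obtain w where w: "w extreme_point_of P" "u \<bullet> v < u \<bullet> w" "\<forall>i\<in>{1, 2, 3}. Z v i = Z w i"
        using step less.prems by blast
      have "{x \<in> ?V. u \<bullet> w < u \<bullet> x} \<subset> {x \<in> ?V. u \<bullet> v < u \<bullet> x}"
        using w(1,2) V by force
      then have "card {x \<in> ?V. u \<bullet> w < u \<bullet> x} < card {x \<in> ?V. u \<bullet> v < u \<bullet> x}"
        by (rule psubset_card_mono[rotated]) (use fin in simp)
      then show ?thesis using less.hyps[OF _ w(1)] w(3) by simp
    qed
  qed
  show ?thesis
  proof (rule that[of "Z top"])
    fix f assume f: "f \<in> two_faces P"
    then have "f face_of P" "f \<noteq> {}" by (auto simp: two_faces_def)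
    then obtain v where v: "v extreme_point_of P" "v \<in> f"
      using vertices_in_face_nonempty[OF poly] by (auto simp: vertices_in_def)
    then have fv: "f \<in> facets_at P v" using f by (simp add: facets_at_def)
    then have "c f \<in> {1, 2, 3}"
      using coloring_bij_at_vertex[OF P c v(1)] unfolding bij_betw_def by blast
    then show "z f = Z top (c f)"
      using Z[OF v(1) fv] const[OF v(1)] by metis
  next
    show "Z top 1 + Z top 2 + Z top 3 = 0"
      using sumZ top(1) V by (simp add: lowest_def)
  qed
qed

section \<open>Point sets with a single affine relation\<close>

text \<open>The coefficients of a relation may vanish, so the points need not form a minimally dependent
  set: those with coefficient zero will be the apexes of a pyramid. Two points of either sign are
  needed in order that every point is a vertex of the hull.\<close>

locale affine_circuit =
  fixes S :: "'a::euclidean_space set" and lam :: "'a \<Rightarrow> real"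
  assumes fin: "finite S"
    and sum_lam: "(\<Sum>x\<in>S. lam x) = 0"
    and comb_lam: "(\<Sum>x\<in>S. lam x *\<^sub>R x) = 0"
    and unique: "\<And>z. (\<Sum>x\<in>S. z x) = 0 \<Longrightarrow> (\<Sum>x\<in>S. z x *\<^sub>R x) = 0 \<Longrightarrow>
      \<exists>\<alpha>. \<forall>x\<in>S. z x = \<alpha> * lam x"
    and two_pos: "card {x \<in> S. lam x > 0} \<ge> 2"
    and two_neg: "card {x \<in> S. lam x < 0} \<ge> 2"
begin

abbreviation "pos \<equiv> {x \<in> S. lam x > 0}"
abbreviation "neg \<equiv> {x \<in> S. lam x < 0}"

text \<open>In terms of the Gale diagram: the points outside \<open>J\<close> either have coefficients of both signs, or
  only zero coefficients.\<close>

definition balanced :: "'a set \<Rightarrow> bool" where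
  "balanced J \<longleftrightarrow> J \<subseteq> S \<and> (pos \<subseteq> J \<longleftrightarrow> neg \<subseteq> J)"

text \<open>A common point of the affine hull of \<open>J\<close> and the convex hull of the other points is an affine
  relation that is nonpositive outside \<open>J\<close>. Being a multiple of \<open>lam\<close>, it vanishes outside \<open>J\<close> when
  \<open>J\<close> is balanced; but there its coefficients sum to \<open>-1\<close>.\<close>

lemma face_if_balanced:
  assumes "balanced J"
  shows "(convex hull J) face_of (convex hull S)"
proof (rule face_of_convex_hulls)
  show JS: "J \<subseteq> S" using assms by (simp add: balanced_def)
  have finJ: "finite J" using JS fin finite_subset by blast
  have finSJ: "finite (S - J)" using fin by blast
  show "affine hull J \<inter> convex hull (S - J) = {}"
  proof (rule ccontr)
    assume "\<not> ?thesis"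
    then obtain y where y: "y \<in> affine hull J" "y \<in> convex hull (S - J)" by blast
    obtain a where a: "sum a J = 1" "(\<Sum>x\<in>J. a x *\<^sub>R x) = y"
      using y(1) affine_hull_finite[OF finJ] by auto
    obtain b where b: "\<forall>x\<in>S - J. 0 \<le> b x" "sum b (S - J) = 1" "(\<Sum>x\<in>S - J. b x *\<^sub>R x) = y"
      using y(2) convex_hull_finite[OF finSJ] by auto
    define z where "z x = (if x \<in> J then a x else - b x)" for x
    have split: "(\<Sum>x\<in>S. h x) = (\<Sum>x\<in>J. h x) + (\<Sum>x\<in>S - J. h x)" for h :: "'a \<Rightarrow> 'b::comm_monoid_add"
      using sum.subset_diff[OF JS fin, of h] by (simp add: add.commute)
    have "(\<Sum>x\<in>S. z x) = 0"
      using a b by (simp add: split z_def sum_negf)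
    moreover have "(\<Sum>x\<in>S. z x *\<^sub>R x) = 0"
      using a b by (simp add: split z_def sum_negf)
    ultimately obtain \<alpha> where \<alpha>: "\<forall>x\<in>S. z x = \<alpha> * lam x"
      using unique by blast
    have nonpos: "\<alpha> * lam x \<le> 0" if "x \<in> S - J" for x
      using b(1) \<alpha> that by (force simp: z_def)
    have "z x = 0" if x: "x \<in> S - J" for x
    proof (cases "pos \<subseteq> J")
      case True
      then have "neg \<subseteq> J" using assms by (simp add: balanced_def)
      then have "lam x = 0" using True x by force
      then show ?thesis using \<alpha> x by simp
    next
      case False
      then obtain p q where p: "p \<in> S - J" "lam p > 0" and q: "q \<in> S - J" "lam q < 0"
        using assms by (auto simp: balanced_def)
      have "\<alpha> \<le> 0" "\<alpha> \<ge> 0"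
        using nonpos[OF p(1)] nonpos[OF q(1)] p q
        by (auto simp: mult_le_0_iff)
      then show ?thesis using \<alpha> x by simp
    qed
    then have "sum b (S - J) = 0"
      by (intro sum.neutral) (auto simp: z_def)
    then show False using b by simp
  qed
qed (rule fin)

lemma extreme_points: "{x. x extreme_point_of (convex hull S)} = S"
proof
  show "S \<subseteq> {x. x extreme_point_of (convex hull S)}"
  proof
    fix x assume "x \<in> S"
    moreover have "\<not> A \<subseteq> {x}" if "card A \<ge> 2" for A :: "'a set"
      using that card_mono[of "{x}" A] by auto
    ultimately have "balanced {x}"
      using two_pos two_neg by (simp add: balanced_def)
    then have "{x} face_of (convex hull S)"
      using face_if_balanced[of "{x}"] by simp
    then show "x \<in> {x. x extreme_point_of (convex hull S)}"
      by (simp add: face_of_singleton)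
  qed
qed (rule extreme_points_of_convex_hull)

lemma hull_Int:
  assumes "J \<subseteq> S"
  shows "convex hull J \<inter> S = J"
proof
  show "convex hull J \<inter> S \<subseteq> J"
  proof
    fix x assume x: "x \<in> convex hull J \<inter> S"
    then have "x extreme_point_of (convex hull S)"
      using extreme_points by blast
    then have "x extreme_point_of (convex hull J)"
      using x hull_mono[OF assms] unfolding extreme_point_of_def by blast
    then show "x \<in> J" by (rule extreme_point_of_convex_hull)
  qed
qed (use assms hull_subset in fastforce)

text \<open>Normalised to positive coefficients of sum 1 on both sides, the relation says that the hulls of the
  positive and of the negative points have a relative interior point in common (the Radon point).\<close>

lemma common_point:
  assumes "A = pos \<and> B = neg \<or> A = neg \<and> B = pos"
  obtains y where "y \<in> convex hull A" "y \<in> rel_interior (convex hull B)"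
proof -
  have fp: "finite pos" "finite neg" using fin by auto
  have "pos \<noteq> {}" using two_pos by force
  define s where "s = sum lam pos"
  have s: "s > 0" unfolding s_def using fp \<open>pos \<noteq> {}\<close> by (intro sum_pos) auto
  have split: "(\<Sum>x\<in>S. h x) = (\<Sum>x\<in>pos. h x) + (\<Sum>x\<in>neg. h x)"
    if "\<And>x. lam x = 0 \<Longrightarrow> h x = 0" for h :: "'a \<Rightarrow> 'b::comm_monoid_add"
  proof -
    have "(\<Sum>x\<in>S. h x) = (\<Sum>x\<in>pos \<union> neg. h x)"
      by (rule sum.mono_neutral_right) (use fin that in \<open>auto simp: not_less order.antisym\<close>)
    also have "\<dots> = (\<Sum>x\<in>pos. h x) + (\<Sum>x\<in>neg. h x)"
      by (rule sum.union_disjoint) (use fin in auto)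
    finally show ?thesis .
  qed
  have s_neg: "sum lam neg = - s"
    using split[of lam] sum_lam by (simp add: s_def)
  \<comment> \<open>The Radon point, as a convex combination of the positive points.\<close>
  define y where "y = (\<Sum>x\<in>pos. (lam x / s) *\<^sub>R x)"
  have y_neg: "y = (\<Sum>x\<in>neg. (- lam x / s) *\<^sub>R x)"
  proof -
    have "(\<Sum>x\<in>pos. lam x *\<^sub>R x) = (\<Sum>x\<in>neg. (- lam x) *\<^sub>R x)"
      using split[of "\<lambda>x. lam x *\<^sub>R x"] comb_lam by (simp add: sum_negf eq_neg_iff_add_eq_0)
    then have "(1/s) *\<^sub>R (\<Sum>x\<in>pos. lam x *\<^sub>R x) = (1/s) *\<^sub>R (\<Sum>x\<in>neg. (- lam x) *\<^sub>R x)"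
      by simp
    then show ?thesis by (simp add: y_def scaleR_sum_right)
  qed
  have w_pos: "(\<Sum>x\<in>pos. lam x / s) = 1"
    using s by (simp add: s_def flip: sum_divide_distrib)
  have w_neg: "(\<Sum>x\<in>neg. - lam x / s) = 1"
    using s s_neg by (simp add: sum_negf flip: sum_divide_distrib)
  have "y \<in> {y. \<exists>u. (\<forall>x\<in>pos. 0 < u x) \<and> sum u pos = 1 \<and> (\<Sum>x\<in>pos. u x *\<^sub>R x) = y}"
    using s w_pos by (intro CollectI exI[of _ "\<lambda>x. lam x / s"]) (simp add: y_def)
  then have in_pos: "y \<in> rel_interior (convex hull pos)"
    using explicit_subset_rel_interior_convex_hull_minimal[OF fp(1)] by blast
  have "y \<in> {y. \<exists>u. (\<forall>x\<in>neg. 0 < u x) \<and> sum u neg = 1 \<and> (\<Sum>x\<in>neg. u x *\<^sub>R x) = y}"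
    using s w_neg y_neg by (intro CollectI exI[of _ "\<lambda>x. - lam x / s"]) (simp add: divide_neg_pos)
  then have in_neg: "y \<in> rel_interior (convex hull neg)"
    using explicit_subset_rel_interior_convex_hull_minimal[OF fp(2)] by blast
  show ?thesis
    using that in_pos in_neg assms rel_interior_subset by blast
qed

text \<open>A face that contains one of the two sign classes contains the Radon point, which is a relative
  interior point of the hull of the other class, and therefore contains that class too.\<close>

lemma balanced_if_face:
  assumes J: "J \<subseteq> S" and face: "(convex hull J) face_of (convex hull S)"
  shows "balanced J"
proof -
  have "B \<subseteq> J" if AB: "A = pos \<and> B = neg \<or> A = neg \<and> B = pos" and "A \<subseteq> J" for A B
  proof -
    obtain y where y: "y \<in> convex hull A" "y \<in> rel_interior (convex hull B)"
      using common_point[OF AB] .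
    have "B \<subseteq> S" using AB by auto
    have "y \<in> convex hull J"
      using y(1) \<open>A \<subseteq> J\<close> hull_mono by blast
    then have "convex hull B \<subseteq> convex hull J"
      using subset_of_face_of[OF face hull_mono[OF \<open>B \<subseteq> S\<close>]] y(2) by blast
    then have "B \<subseteq> convex hull J \<inter> S"
      using \<open>B \<subseteq> S\<close> hull_subset[of B convex] by simp
    then show ?thesis using hull_Int[OF J] by simp
  qed
  then show ?thesis using J by (auto simp: balanced_def)
qed

lemma face_iff_balanced: "J \<subseteq> S \<Longrightarrow> (convex hull J) face_of (convex hull S) \<longleftrightarrow> balanced J"
  using face_if_balanced balanced_if_face by blast

lemma face_eq_hull:
  assumes "F face_of (convex hull S)"
  shows "balanced (F \<inter> S)" "F = convex hull (F \<inter> S)"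
proof -
  obtain J where J: "J \<subseteq> S" "F = convex hull J"
    using face_of_convex_hull_subset[OF finite_imp_compact[OF fin] assms] by blast
  then have "F \<inter> S = J" using hull_Int by simp
  then show "balanced (F \<inter> S)" "F = convex hull (F \<inter> S)"
    using J assms face_iff_balanced by simp_all
qed

text \<open>Omitting a point whose coefficient is not zero leaves an affinely independent set with the same
  affine hull.\<close>

lemma aff_dim_circuit: "aff_dim S = int (card S) - 2"
proof -
  have "pos \<noteq> {}" using two_pos by force
  then obtain p where p: "p \<in> S" "lam p > 0" by blast
  let ?B = "S - {p}"
  have indep: "\<not> affine_dependent ?B"
  proof
    assume "affine_dependent ?B"
    then obtain U where U: "sum U ?B = 0" "\<exists>v\<in>?B. U v \<noteq> 0" "(\<Sum>v\<in>?B. U v *\<^sub>R v) = 0"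
      using affine_dependent_explicit_finite[of ?B] fin by auto
    define z where "z x = (if x = p then 0 else U x)" for x
    have "(\<Sum>x\<in>S. z x) = 0"
      using U sum.remove[OF fin p(1), of z] by (simp add: z_def)
    moreover have "(\<Sum>x\<in>S. z x *\<^sub>R x) = 0"
      using U sum.remove[OF fin p(1), of "\<lambda>x. z x *\<^sub>R x"] by (simp add: z_def)
    ultimately obtain \<alpha> where \<alpha>: "\<forall>x\<in>S. z x = \<alpha> * lam x"
      using unique by blast
    then have "\<alpha> = 0" using p by (auto simp: z_def)
    then show False using \<alpha> U(2) by (force simp: z_def split: if_splits)
  qed
  have "p \<in> affine hull ?B"
  proof -
    have "lam p + sum lam ?B = 0"
      using sum.remove[OF fin p(1), of lam] sum_lam by simp
    then have "sum lam ?B = - lam p"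
      by simp
    then have 1: "(\<Sum>x\<in>?B. - lam x / lam p) = 1"
      using p by (simp add: sum_negf flip: sum_divide_distrib)
    have "lam p *\<^sub>R p + (\<Sum>x\<in>?B. lam x *\<^sub>R x) = 0"
      using sum.remove[OF fin p(1), of "\<lambda>x. lam x *\<^sub>R x"] comb_lam by simp
    then have "lam p *\<^sub>R p = (\<Sum>x\<in>?B. (- lam x) *\<^sub>R x)"
      by (simp add: sum_negf eq_neg_iff_add_eq_0)
    then have "(1 / lam p) *\<^sub>R (lam p *\<^sub>R p) = (1 / lam p) *\<^sub>R (\<Sum>x\<in>?B. (- lam x) *\<^sub>R x)"
      by simp
    then have "p = (\<Sum>x\<in>?B. (- lam x / lam p) *\<^sub>R x)"
      using p by (simp add: scaleR_sum_right)
    then have "p \<in> {y. \<exists>u. sum u ?B = 1 \<and> (\<Sum>x\<in>?B. u x *\<^sub>R x) = y}"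
      using 1 by (intro CollectI exI[of _ "\<lambda>x. - lam x / lam p"]) simp
    then show ?thesis
      using fin by (subst affine_hull_finite) auto
  qed
  then have "aff_dim S = aff_dim ?B"
    using aff_dim_insert[of p ?B] p by (simp add: insert_absorb)
  then show ?thesis
    using aff_dim_affine_independent[OF indep] card_Suc_Diff1[OF fin p(1)] by linarith
qed

text \<open>The points with nonzero coefficient form a balanced set. All of them are vertices of its hull, yet
  they are affinely dependent.\<close>

lemma not_simplicial:
  assumes "pos \<union> neg \<noteq> S"
  shows "\<not> simplicial_polytope (convex hull S)"
proof
  let ?J = "pos \<union> neg"
  assume simp: "simplicial_polytope (convex hull S)"
  have bal: "balanced ?J" by (auto simp: balanced_def)
  have JS: "?J \<subseteq> S" by auto
  have "convex hull ?J \<noteq> convex hull S"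
    using hull_Int[OF JS] hull_Int[of S] assms by auto
  then obtain k where "k simplex (convex hull ?J)"
    using simp face_if_balanced[OF bal] by (auto simp: simplicial_polytope_def proper_face_of_def)
  then obtain C where C: "\<not> affine_dependent C" "convex hull ?J = convex hull C"
    by (auto simp: simplex_def)
  have ext: "x extreme_point_of (convex hull ?J) \<longleftrightarrow> x \<in> ?J" for x
  proof -
    have "x extreme_point_of (convex hull ?J) \<longleftrightarrow> x \<in> S \<and> x \<in> convex hull ?J"
      using extreme_point_of_face[OF face_if_balanced[OF bal]] extreme_points by blast
    then show ?thesis using hull_Int[OF JS] by blast
  qed
  have "x \<in> C" if "x \<in> ?J" for x
    using ext[of x] that C(2) extreme_point_of_convex_hull by metis
  moreover have "x \<in> ?J" if "x \<in> C" for x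
    using extreme_point_of_convex_hull_affine_independent[OF C(1)] that ext C(2) by metis
  ultimately have "C = ?J" by blast
  moreover have "affine_dependent ?J"
  proof -
    have zero: "\<forall>x\<in>S - ?J. lam x = 0" "\<forall>x\<in>S - ?J. lam x *\<^sub>R x = 0"
      by force+
    have "sum lam ?J = 0"
      using sum.mono_neutral_left[OF fin JS zero(1)] sum_lam by metis
    moreover have "(\<Sum>x\<in>?J. lam x *\<^sub>R x) = 0"
      using sum.mono_neutral_left[OF fin JS zero(2)] comb_lam by metis
    moreover have "pos \<noteq> {}"
      using two_pos by force
    then obtain p where "p \<in> pos" by blast
    then have "p \<in> ?J" "lam p \<noteq> 0" by auto
    moreover have "finite ?J" using fin by simp
    ultimately show ?thesis
      unfolding affine_dependent_explicit_finite[OF \<open>finite ?J\<close>] by blast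
  qed
  ultimately show False using C by simp
qed

end

lemma card_filter_image:
  assumes inj: "inj_on p I"
  shows "card {x \<in> p ` I. Q (\<mu> (inv_into I p x))} = card {i \<in> I. Q (\<mu> i)}"
proof -
  have "{x \<in> p ` I. Q (\<mu> (inv_into I p x))} = p ` {i \<in> I. Q (\<mu> i)}"
    using inv_into_f_f[OF inj] by auto
  moreover have "inj_on p {i \<in> I. Q (\<mu> i)}"
    using inj by (rule inj_on_subset) auto
  ultimately show ?thesis by (simp add: card_image)
qed

text \<open>In both applications the points and the coefficients are given as families over an index set.\<close>

lemma affine_circuit_family:
  fixes p :: "'i \<Rightarrow> 'a::euclidean_space"
  assumes I: "finite I" and inj: "inj_on p I"
    and sum_mu: "(\<Sum>i\<in>I. \<mu> i) = 0" and comb_mu: "(\<Sum>i\<in>I. \<mu> i *\<^sub>R p i) = 0"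
    and unique: "\<And>z. (\<Sum>i\<in>I. z i) = 0 \<Longrightarrow> (\<Sum>i\<in>I. z i *\<^sub>R p i) = 0 \<Longrightarrow>
      \<exists>\<alpha>. \<forall>i\<in>I. z i = \<alpha> * \<mu> i"
    and two: "card {i \<in> I. \<mu> i > 0} \<ge> 2" "card {i \<in> I. \<mu> i < 0} \<ge> 2"
  shows "affine_circuit (p ` I) (\<lambda>x. \<mu> (inv_into I p x))"
proof -
  let ?lam = "\<lambda>x. \<mu> (inv_into I p x)"
  have lam: "?lam (p i) = \<mu> i" if "i \<in> I" for i
    using inj that by simp
  show ?thesis
  proof
    show "finite (p ` I)" using I by simp
    show "(\<Sum>x\<in>p ` I. ?lam x) = 0" "(\<Sum>x\<in>p ` I. ?lam x *\<^sub>R x) = 0"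
      using sum_mu comb_mu by (simp_all add: sum.reindex[OF inj] lam)
    show "\<exists>\<alpha>. \<forall>x\<in>p ` I. z x = \<alpha> * ?lam x"
      if "(\<Sum>x\<in>p ` I. z x) = 0" "(\<Sum>x\<in>p ` I. z x *\<^sub>R x) = 0" for z
      using unique[of "z \<circ> p"] that by (simp add: sum.reindex[OF inj] lam)
    show "2 \<le> card {x \<in> p ` I. 0 < ?lam x}" "2 \<le> card {x \<in> p ` I. ?lam x < 0}"
      using two card_filter_image[OF inj, of "\<lambda>t::real. 0 < t"] card_filter_image[OF inj, of "\<lambda>t::real. t < 0"]
      by simp_all
  qed
qed

context affine_circuit begin

lemma card_sgn:
  "card {x \<in> S. sgn (lam x) = s} =
    (if s = 1 then card pos else if s = - 1 then card neg
     else if s = 0 then card S - card pos - card neg else 0)"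
proof -
  have "sgn (lam x) = 1 \<longleftrightarrow> lam x > 0" "sgn (lam x) = - 1 \<longleftrightarrow> lam x < 0" "sgn (lam x) = 0 \<longleftrightarrow> lam x = 0" for x
    by (simp_all add: sgn_1_pos sgn_1_neg sgn_zero_iff)
  moreover have "{x \<in> S. lam x = 0} = S - pos - neg" by auto
  then have "card {x \<in> S. lam x = 0} = card S - card pos - card neg"
    using fin card_Diff_subset[of pos S] card_Diff_subset[of neg "S - pos"] by force
  moreover have "s = 1 \<or> s = - 1 \<or> s = 0" if "sgn (lam x) = s" for x
    using that by (auto simp: sgn_if)
  then have "{x \<in> S. sgn (lam x) = s} = {}" if "s \<noteq> 1" "s \<noteq> - 1" "s \<noteq> 0"
    using that by blast
  then have "card {x \<in> S. sgn (lam x) = s} = 0" if "s \<noteq> 1" "s \<noteq> - 1" "s \<noteq> 0"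
    using that card.empty by metis
  ultimately show ?thesis by auto
qed

lemma sum_list_index:
  assumes "distinct vs" "set vs = S"
  shows "(\<Sum>j<length vs. h (vs ! j)) = (\<Sum>x\<in>S. h x)"
  using sum.reindex_bij_betw[OF bij_betw_nth[OF assms(1) refl assms(2)[symmetric]], of h] .

text \<open>The relation, listed along the points, is a basis of the one-dimensional space of relations, so
  its coefficients are the Gale transform in \<open>\<real>\<close>.\<close>

lemma gale_diagram_circuit:
  "polytope_gale_diagram (convex hull S)
    (replicate_mset (card S - card pos - card neg) (0::real)
      + replicate_mset (card pos) 1 + replicate_mset (card neg) (- 1))"
proof -
  obtain vs where vs: "set vs = S" "distinct vs"
    using finite_distinct_list[OF fin] by blast
  let ?N = "length vs"
  have N: "?N = card S" using vs distinct_card by fastforce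
  note sums = sum_list_index[OF vs(2,1)]
  let ?\<beta> = "\<lambda>b::real. \<lambda>j. lam (vs ! j)"
  have "affine_relation_basis vs (Basis :: real set) ?\<beta>"
    unfolding affine_relation_basis_def
  proof (intro conjI ballI allI impI)
    show "affine_relation vs (\<lambda>j. lam (vs ! j))"
      using sums[of lam] sums[of "\<lambda>x. lam x *\<^sub>R x"] sum_lam comb_lam
      by (simp add: affine_relation_def)
  next
    fix a :: "real \<Rightarrow> real" and b :: real
    assume a: "\<forall>j<?N. (\<Sum>b\<in>(Basis :: real set). a b * lam (vs ! j)) = 0" and b: "b \<in> Basis"
    have "pos \<noteq> {}" using two_pos by force
    then obtain p where "p \<in> set vs" "lam p > 0" using vs by blast
    then obtain j where "j < ?N" "lam (vs ! j) > 0" by (auto simp: in_set_conv_nth)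
    then show "a b = 0" using a b by auto
  next
    fix z assume z: "affine_relation vs z"
    let ?y = "\<lambda>x. z (inv_into {..<?N} ((!) vs) x)"
    have y: "?y (vs ! j) = z j" if "j < ?N" for j
      using inj_on_nth[OF vs(2), of "{..<?N}"] that by simp
    have "(\<Sum>x\<in>S. ?y x) = 0" "(\<Sum>x\<in>S. ?y x *\<^sub>R x) = 0"
      using z y sums[of ?y] sums[of "\<lambda>x. ?y x *\<^sub>R x"] by (simp_all add: affine_relation_def)
    then obtain \<alpha> where "\<forall>x\<in>S. ?y x = \<alpha> * lam x" using unique by blast
    then have "z j = \<alpha> * lam (vs ! j)" if "j < ?N" for j
      using y[OF that] vs(1) that nth_mem by metis
    then show "\<exists>a. \<forall>j<?N. z j = (\<Sum>b\<in>(Basis :: real set). a b * lam (vs ! j))"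
      by (intro exI[of _ "\<lambda>_. \<alpha>"]) simp
  qed simp
  moreover have "int DIM(real) = int ?N - aff_dim (convex hull (set vs)) - 1"
    using aff_dim_circuit by (simp add: N vs aff_dim_convex_hull)
  moreover have "map lam vs = map (\<lambda>j. \<Sum>b\<in>Basis. ?\<beta> b j *\<^sub>R b) [0..<?N]"
    by (rule nth_equalityI) simp_all
  ultimately have "gale_transform vs (map lam vs)"
    unfolding gale_transform_def by (intro conjI exI[of _ ?\<beta>])
  moreover have "mset (map sgn (map lam vs)) =
      replicate_mset (card S - card pos - card neg) (0::real)
      + replicate_mset (card pos) 1 + replicate_mset (card neg) (- 1)" (is "?L = ?R")
  proof (rule multiset_eqI)
    fix s
    have "mset vs = mset_set S" using mset_set_set[OF vs(2)] vs(1) by simp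
    then have "?L = image_mset (\<lambda>x. sgn (lam x)) (mset_set S)"
      by (simp add: multiset.map_comp o_def)
    also have "count \<dots> s = card {x \<in> S. sgn (lam x) = s}"
      by (rule count_image_mset_eq_card_vimage[OF fin])
    finally show "count ?L s = count ?R s"
      by (simp add: card_sgn)
  qed
  ultimately show ?thesis
    unfolding polytope_gale_diagram_def gale_diagram_def using vs extreme_points by metis
qed

end

section \<open>The combinatorial type of a circuit\<close>

text \<open>Faces correspond to balanced sets of points, and being balanced refers to the signs only.\<close>

lemma circuits_combinatorially_equivalent:
  assumes S: "affine_circuit S lam" and S': "affine_circuit S' lam'"
    and g: "bij_betw g S S'" and sgn: "\<And>x. x \<in> S \<Longrightarrow> sgn (lam' (g x)) = sgn (lam x)"
  shows "combinatorially_equivalent (convex hull S) (convex hull S')"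
proof -
  interpret S: affine_circuit S lam by fact
  interpret S': affine_circuit S' lam' by fact
  have inj: "inj_on g S" and im: "g ` S = S'"
    using g by (auto simp: bij_betw_def)
  have pos_iff: "lam' (g x) > 0 \<longleftrightarrow> lam x > 0" and neg_iff: "lam' (g x) < 0 \<longleftrightarrow> lam x < 0"
    if "x \<in> S" for x
    using sgn[OF that] by (auto simp: sgn_if split: if_splits)
  have pos: "S'.pos = g ` S.pos" and neg: "S'.neg = g ` S.neg"
    using im pos_iff neg_iff by auto
  have sub: "g ` A \<subseteq> g ` J \<longleftrightarrow> A \<subseteq> J" if "A \<subseteq> S" "J \<subseteq> S" for A J
    using inj_on_image_subset_iff[OF inj that] .
  have bal: "S'.balanced (g ` J) \<longleftrightarrow> S.balanced J" if "J \<subseteq> S" for J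
    using that im sub[of S.pos J] sub[of S.neg J]
    by (auto simp: S.balanced_def S'.balanced_def pos neg)
  define \<phi> where "\<phi> F = convex hull (g ` (F \<inter> S))" for F
  have \<phi>_Int: "\<phi> F \<inter> S' = g ` (F \<inter> S)" for F
    unfolding \<phi>_def by (rule S'.hull_Int) (use im in auto)
  have mono: "F \<subseteq> F' \<longleftrightarrow> \<phi> F \<subseteq> \<phi> F'" if F: "F face_of (convex hull S)" "F' face_of (convex hull S)" for F F'
  proof
    assume "F \<subseteq> F'"
    then show "\<phi> F \<subseteq> \<phi> F'" unfolding \<phi>_def by (intro hull_mono) auto
  next
    assume "\<phi> F \<subseteq> \<phi> F'"
    then have "\<phi> F \<inter> S' \<subseteq> \<phi> F' \<inter> S'" by blast
    then have "F \<inter> S \<subseteq> F' \<inter> S"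
      unfolding \<phi>_Int using sub by simp
    then have "convex hull (F \<inter> S) \<subseteq> convex hull (F' \<inter> S)"
      by (rule hull_mono)
    then show "F \<subseteq> F'" using F S.face_eq_hull(2) by metis
  qed
  have "bij_betw \<phi> {F. F face_of (convex hull S)} {G. G face_of (convex hull S')}"
    unfolding bij_betw_def
  proof
    show "inj_on \<phi> {F. F face_of (convex hull S)}"
      by (rule inj_onI) (metis mono mem_Collect_eq subset_antisym order_refl)
    show "\<phi> ` {F. F face_of (convex hull S)} = {G. G face_of (convex hull S')}"
    proof (intro equalityI subsetI)
      fix G assume "G \<in> \<phi> ` {F. F face_of (convex hull S)}"
      then obtain F where F: "F face_of (convex hull S)" "G = \<phi> F" by blast
      then show "G \<in> {G. G face_of (convex hull S')}"
        using S'.face_if_balanced bal[of "F \<inter> S"] S.face_eq_hull(1)[OF F(1)] by (simp add: \<phi>_def)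
    next
      fix G assume "G \<in> {G. G face_of (convex hull S')}"
      then have G: "S'.balanced (G \<inter> S')" "G = convex hull (G \<inter> S')"
        using S'.face_eq_hull by blast+
      define J where "J = {x \<in> S. g x \<in> G}"
      have J: "J \<subseteq> S" "g ` J = G \<inter> S'" using im by (auto simp: J_def)
      then have "(convex hull J) face_of (convex hull S)"
        using bal[of J] G(1) S.face_if_balanced by simp
      moreover have "\<phi> (convex hull J) = G"
        using S.hull_Int[OF J(1)] J(2) G(2) by (simp add: \<phi>_def)
      ultimately show "G \<in> \<phi> ` {F. F face_of (convex hull S)}" by blast
    qed
  qed
  then show ?thesis
    unfolding combinatorially_equivalent_def using mono by blast
qed

text \<open>Glue bijections between the fibres of \<open>h\<close> and \<open>h'\<close>.\<close>

lemma bij_betw_preserving: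
  assumes fin: "finite S" "finite S'"
    and card: "\<And>s. card {x \<in> S. h x = s} = card {y \<in> S'. h' y = s}"
  obtains g where "bij_betw g S S'" "\<And>x. x \<in> S \<Longrightarrow> h' (g x) = h x"
proof -
  have "\<exists>g. bij_betw g {x \<in> S. h x = s} {y \<in> S'. h' y = s}" for s
    using fin card by (intro finite_same_card_bij) auto
  then obtain G where G: "\<And>s. bij_betw (G s) {x \<in> S. h x = s} {y \<in> S'. h' y = s}"
    by metis
  define g where "g x = G (h x) x" for x
  have g: "g x \<in> S'" "h' (g x) = h x" if "x \<in> S" for x
    using bij_betwE[OF G[of "h x"]] that by (auto simp: g_def)
  have "inj_on g S"
  proof (rule inj_onI)
    fix x y assume xy: "x \<in> S" "y \<in> S" "g x = g y"
    then have h: "h x = h y" using g by metis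
    then have "G (h x) x = G (h x) y" using xy by (simp add: g_def)
    then show "x = y"
      using bij_betw_imp_inj_on[OF G[of "h x"]] xy h by (simp add: inj_on_def)
  qed
  moreover have "y \<in> g ` S" if y: "y \<in> S'" for y
  proof -
    obtain x where x: "x \<in> S" "h x = h' y" "y = G (h' y) x"
      using bij_betw_imp_surj_on[OF G[of "h' y"]] y by blast
    then have "y = g x" by (simp add: g_def)
    then show ?thesis using x(1) by blast
  qed
  ultimately have "bij_betw g S S'"
    using g by (auto simp: bij_betw_def)
  then show ?thesis using that g by blast
qed

lemma circuits_same_counts_equivalent:
  assumes S: "affine_circuit S lam" and S': "affine_circuit S' lam'"
    and card: "card S = card S'"
      "card {x \<in> S. lam x > 0} = card {x \<in> S'. lam' x > 0}"
      "card {x \<in> S. lam x < 0} = card {x \<in> S'. lam' x < 0}"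
  shows "combinatorially_equivalent (convex hull S) (convex hull S')"
proof -
  interpret S: affine_circuit S lam by fact
  interpret S': affine_circuit S' lam' by fact
  have "card {x \<in> S. sgn (lam x) = s} = card {y \<in> S'. sgn (lam' y) = s}" for s
    unfolding S.card_sgn S'.card_sgn card ..
  then obtain g where "bij_betw g S S'" "\<And>x. x \<in> S \<Longrightarrow> sgn (lam' (g x)) = sgn (lam x)"
    using bij_betw_preserving[OF S.fin S'.fin, of "\<lambda>x. sgn (lam x)" "\<lambda>y. sgn (lam' y)"] by blast
  then show ?thesis
    using circuits_combinatorially_equivalent[OF S S'] by blast
qed

section \<open>Cyclic polytopes and iterated pyramids over them\<close>

lemma moment_relation_poly:
  fixes z :: "nat \<Rightarrow> real"
  assumes z: "\<And>i. i \<le> d \<Longrightarrow> (\<Sum>j\<in>A. z j * real j ^ i) = 0" and q: "degree q \<le> d"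
  shows "(\<Sum>j\<in>A. z j * poly q (real j)) = 0"
proof -
  have "(\<Sum>j\<in>A. z j * poly q (real j)) = (\<Sum>j\<in>A. \<Sum>i\<le>degree q. coeff q i * (z j * real j ^ i))"
    by (simp add: poly_altdef sum_distrib_left mult_ac)
  also have "\<dots> = (\<Sum>i\<le>degree q. coeff q i * (\<Sum>j\<in>A. z j * real j ^ i))"
    by (simp add: sum.swap[of _ A] sum_distrib_left)
  also have "\<dots> = 0" using z q by simp
  finally show ?thesis .
qed

text \<open>Apply the relation to the polynomial of degree \<open>d\<close> that vanishes at all the points except \<open>j\<close> and
  \<open>j + 1\<close>. It has equal signs at these two points because it has no root between them.\<close>

lemma moment_relation_consecutive:
  fixes z :: "nat \<Rightarrow> real"
  assumes z: "\<And>i. i \<le> d \<Longrightarrow> (\<Sum>j<d + 2. z j * real j ^ i) = 0" and j: "j < d + 1"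
  shows "sgn (z (Suc j)) = - sgn (z j)"
proof -
  let ?R = "{..<d + 2} - {j, Suc j}"
  define q where "q = (\<Prod>s\<in>?R. [:- real s, 1:])"
  have q: "poly q x = (\<Prod>s\<in>?R. x - real s)" for x
    by (simp add: q_def poly_prod)
  have cardR: "card ?R = d"
    using j by (subst card_Diff_subset) auto
  have "degree q \<le> (\<Sum>s\<in>?R. degree [:- real s, 1:])"
    unfolding q_def using degree_prod_sum_le[of ?R "\<lambda>s. [:- real s, 1:]"] by (simp add: o_def)
  then have "degree q \<le> d" using cardR by simp
  then have "0 = (\<Sum>s<d + 2. z s * poly q (real s))"
    using moment_relation_poly[OF z, where q=q] by simp
  also have "\<dots> = (\<Sum>s\<in>{j, Suc j}. z s * poly q (real s))"
  proof (rule sum.mono_neutral_right)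
    show "\<forall>s\<in>{..<d + 2} - {j, Suc j}. z s * poly q (real s) = 0"
      unfolding q by auto
  qed (use j in auto)
  finally have eq: "z j * poly q (real j) = - (z (Suc j) * poly q (real (Suc j)))"
    by simp
  have "0 < (\<Prod>s\<in>?R. (real j - real s) * (real (Suc j) - real s))"
  proof (rule prod_pos)
    fix s assume "s \<in> ?R"
    then have "s < j \<or> Suc j < s" by auto
    then show "0 < (real j - real s) * (real (Suc j) - real s)"
      by (auto intro: mult_neg_neg)
  qed
  then have "0 < poly q (real j) * poly q (real (Suc j))"
    by (simp add: q prod.distrib)
  then have "sgn (poly q (real j)) = sgn (poly q (real (Suc j)))" "poly q (real j) \<noteq> 0"
    by (auto simp: zero_less_mult_iff)
  moreover have "sgn (z j) * sgn (poly q (real j)) = - (sgn (z (Suc j)) * sgn (poly q (real (Suc j))))"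
    using arg_cong[OF eq, of sgn] by (simp only: sgn_mult sgn_minus)
  ultimately show ?thesis
    by (auto simp: sgn_if split: if_splits)
qed

text \<open>In particular a relation that vanishes at one point vanishes everywhere, so relations are unique up
  to a factor.\<close>

lemma moment_relation_alternates:
  fixes z :: "nat \<Rightarrow> real"
  assumes z: "\<And>i. i \<le> d \<Longrightarrow> (\<Sum>j<d + 2. z j * real j ^ i) = 0" and j: "j < d + 2"
  shows "sgn (z j) = (- 1) ^ j * sgn (z 0)"
  using j
proof (induction j)
  case (Suc j)
  then show ?case using moment_relation_consecutive[OF z, of j] by simp
qed simp

lemma card_even_odd_less: "card {j. j < 2 * k \<and> even j} = k" "card {j. j < 2 * k \<and> odd j} = (k::nat)"
proof -
  have "{j. j < 2 * k \<and> even j} = (\<lambda>i. 2 * i) ` {..<k}"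
    by (auto elim!: evenE)
  then show "card {j. j < 2 * k \<and> even j} = k"
    by (simp add: card_image inj_on_def)
  have "{j. j < 2 * k \<and> odd j} = (\<lambda>i. 2 * i + 1) ` {..<k}"
    by (auto elim!: oddE)
  then show "card {j. j < 2 * k \<and> odd j} = k"
    by (simp add: card_image inj_on_def)
qed

definition moment_curve :: "(nat \<Rightarrow> 'a::euclidean_space) \<Rightarrow> nat \<Rightarrow> real \<Rightarrow> 'a" where
  "moment_curve e d t = (\<Sum>i = 1..d. t ^ i *\<^sub>R e i)"

text \<open>The points \<open>0, \<dots>, d + 1\<close> of the moment curve, followed by the basis vectors \<open>e (d + 1)\<close>,
  \<open>e (d + 2)\<close>, \<dots> that serve as apexes; the shift by one makes the numbering contiguous.\<close>

definition moment_or_apex :: "(nat \<Rightarrow> 'a::euclidean_space) \<Rightarrow> nat \<Rightarrow> nat \<Rightarrow> 'a" where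
  "moment_or_apex e d j = (if j < d + 2 then moment_curve e d (real j) else e (j - 1))"

locale coordinate_frame =
  fixes e :: "nat \<Rightarrow> 'a::euclidean_space" and d R :: nat
  assumes inj_e: "inj_on e {1..d + R}" and Basis_e: "e ` {1..d + R} \<subseteq> Basis"
    and d: "even d" "d \<ge> 2"
begin

lemma inner_e: "i \<in> {1..d + R} \<Longrightarrow> j \<in> {1..d + R} \<Longrightarrow> e i \<bullet> e j = (if i = j then 1 else 0)"
  using inj_e Basis_e by (subst inner_Basis) (auto simp: inj_on_eq_iff)

lemma inner_moment_curve:
  assumes "k \<in> {1..d + R}"
  shows "moment_curve e d t \<bullet> e k = (if k \<le> d then t ^ k else 0)"
proof -
  have "moment_curve e d t \<bullet> e k = (\<Sum>i = 1..d. if i = k then t ^ k else 0)"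
    unfolding moment_curve_def inner_sum_left
    by (intro sum.cong refl) (use assms in \<open>auto simp: inner_e\<close>)
  then show ?thesis using assms by simp
qed

lemma inner_moment_or_apex:
  assumes "k \<in> {1..d + R}" "j < d + 2 + R"
  shows "moment_or_apex e d j \<bullet> e k =
    (if k \<le> d then (if j < d + 2 then real j ^ k else 0) else (if j = Suc k then 1 else 0))"
proof (cases "j < d + 2")
  case True
  then show ?thesis using assms by (simp add: moment_or_apex_def inner_moment_curve)
next
  case False
  then have "e (j - 1) \<bullet> e k = (if j - 1 = k then 1 else 0)"
    using assms by (intro inner_e) auto
  then show ?thesis using False by (auto simp: moment_or_apex_def)
qed

lemma inj_moment_or_apex: "inj_on (moment_or_apex e d) {..<d + 2 + R}"
proof (rule inj_onI)
  fix i j assume ij: "i \<in> {..<d + 2 + R}" "j \<in> {..<d + 2 + R}"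
    and eq: "moment_or_apex e d i = moment_or_apex e d j"
  have eqk: "moment_or_apex e d i \<bullet> e k = moment_or_apex e d j \<bullet> e k" for k
    using eq by simp
  have "i = j" if "i \<ge> d + 2" "i < d + 2 + R" "j < d + 2 + R"
    "moment_or_apex e d i \<bullet> e (i - 1) = moment_or_apex e d j \<bullet> e (i - 1)" for i j
  proof -
    have "i - 1 \<in> {1..d + R}" "\<not> i - 1 \<le> d" "Suc (i - 1) = i" using that by auto
    then show ?thesis
      using that by (simp only: inner_moment_or_apex) (auto split: if_splits)
  qed
  then have "i = j" if "i \<ge> d + 2 \<or> j \<ge> d + 2"
    using that eqk ij by (metis lessThan_iff)
  moreover have "i = j" if "i < d + 2" "j < d + 2"
    using eqk[of 1] ij that d by (simp add: inner_moment_or_apex)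
  ultimately show "i = j" by linarith
qed

text \<open>Compare coordinates: those up to \<open>d\<close> are the power moments of the coefficients on the curve, and
  each coordinate beyond \<open>d\<close> is met by one apex only.\<close>

lemma relation_iff_moments:
  assumes r: "r \<le> R"
  shows "(\<Sum>j<d + 2 + r. z j) = 0 \<and> (\<Sum>j<d + 2 + r. z j *\<^sub>R moment_or_apex e d j) = 0
    \<longleftrightarrow> (\<forall>i\<le>d. (\<Sum>j<d + 2. z j * real j ^ i) = 0) \<and> (\<forall>j\<in>{d + 2..<d + 2 + r}. z j = 0)"
    (is "?rel \<longleftrightarrow> ?moments \<and> ?apex")
proof
  have coord: "(\<Sum>j<d + 2 + r. z j *\<^sub>R moment_or_apex e d j) \<bullet> e k
      = (if k \<le> d then \<Sum>j<d + 2. z j * real j ^ k else if k \<le> d + r then z (Suc k) else 0)"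
    if k: "k \<in> {1..d + R}" for k
  proof (cases "k \<le> d")
    case True
    have "(\<Sum>j<d + 2 + r. z j *\<^sub>R moment_or_apex e d j) \<bullet> e k
        = (\<Sum>j<d + 2 + r. if j < d + 2 then z j * real j ^ k else 0)"
      unfolding inner_sum_left
      by (intro sum.cong refl) (use k r True in \<open>simp add: inner_moment_or_apex\<close>)
    also have "\<dots> = (\<Sum>j<d + 2. z j * real j ^ k)"
      by (rule sum.mono_neutral_cong_right) auto
    finally show ?thesis using True by simp
  next
    case False
    have "(\<Sum>j<d + 2 + r. z j *\<^sub>R moment_or_apex e d j) \<bullet> e k
        = (\<Sum>j<d + 2 + r. if j = Suc k then z (Suc k) else 0)"
      unfolding inner_sum_left
      by (intro sum.cong refl) (use k r False in \<open>simp add: inner_moment_or_apex\<close>)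
    then show ?thesis using False by auto
  qed
  have low: "(\<Sum>j<d + 2 + r. z j) = (\<Sum>j<d + 2. z j)" if ?apex
    by (rule sum.mono_neutral_right) (use that in auto)
  {
    assume rel: ?rel
    have apex: ?apex
    proof
      fix j assume j: "j \<in> {d + 2..<d + 2 + r}"
      then have "j - 1 \<in> {1..d + R}" "\<not> j - 1 \<le> d" "j - 1 \<le> d + r" "Suc (j - 1) = j"
        using r by auto
      then show "z j = 0" using coord[of "j - 1"] rel by simp
    qed
    moreover have ?moments
    proof (intro allI impI)
      fix i assume "i \<le> d"
      then show "(\<Sum>j<d + 2. z j * real j ^ i) = 0"
        using coord[of i] rel low[OF apex] by (cases "i = 0") auto
    qed
    ultimately show "?moments \<and> ?apex" by blast
  }
  assume asm: "?moments \<and> ?apex"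
  have "(\<Sum>j<d + 2. z j) = 0" using asm[THEN conjunct1, rule_format, of 0] by simp
  moreover have "(\<Sum>j<d + 2 + r. z j *\<^sub>R moment_or_apex e d j)
      = (\<Sum>j<d + 2. z j *\<^sub>R (\<Sum>i = 1..d. real j ^ i *\<^sub>R e i))"
    by (rule sum.mono_neutral_cong_right)
      (use asm in \<open>auto simp: moment_or_apex_def moment_curve_def\<close>)
  moreover have "\<dots> = (\<Sum>i = 1..d. (\<Sum>j<d + 2. z j * real j ^ i) *\<^sub>R e i)"
    by (simp only: scaleR_sum_right scaleR_scaleR scaleR_sum_left sum.swap[of _ "{..<d + 2}"])
  ultimately show ?rel using asm low by simp
qed

text \<open>The \<open>d + 2\<close> points lie in a space of dimension \<open>d\<close>, so they are affinely dependent.\<close>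

lemma exists_moment_relation:
  obtains \<mu> :: "nat \<Rightarrow> real" where "\<And>i. i \<le> d \<Longrightarrow> (\<Sum>j<d + 2. \<mu> j * real j ^ i) = 0"
    "\<mu> 0 > 0" "\<And>j. j \<ge> d + 2 \<Longrightarrow> \<mu> j = 0"
proof -
  let ?p = "moment_or_apex e d" and ?J = "{..<d + 2}"
  have inj: "inj_on ?p ?J"
    by (rule inj_on_subset[OF inj_moment_or_apex]) auto
  have "?p ` ?J \<subseteq> span (e ` {1..d})"
  proof
    fix x assume "x \<in> ?p ` ?J"
    then obtain j where "x = (\<Sum>i = 1..d. real j ^ i *\<^sub>R e i)"
      by (auto simp: moment_or_apex_def moment_curve_def)
    then show "x \<in> span (e ` {1..d})"
      by (simp only:) (intro span_sum span_scale span_base imageI)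
  qed
  then have "aff_dim (?p ` ?J) \<le> int (dim (e ` {1..d}))"
    using aff_dim_subset[of "?p ` ?J" "span (e ` {1..d})"] aff_dim_subspace[of "span (e ` {1..d})"]
    by (metis dim_span subspace_span)
  also have "\<dots> \<le> int d"
    using dim_le_card'[of "e ` {1..d}"] card_image_le[of "{1..d}" e] by simp
  finally have "affine_dependent (?p ` ?J)"
    using aff_dim_affine_independent[of "?p ` ?J"] unfolding card_image[OF inj] card_lessThan
    by (cases "affine_dependent (?p ` ?J)") simp_all
  then obtain U where U: "sum U (?p ` ?J) = 0" "\<exists>v\<in>?p ` ?J. U v \<noteq> 0" "(\<Sum>v\<in>?p ` ?J. U v *\<^sub>R v) = 0"
    using affine_dependent_explicit_finite[of "?p ` ?J"] by blast
  define z where "z j = U (?p j)" for j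
  have "(\<Sum>j<d + 2 + 0. z j) = 0 \<and> (\<Sum>j<d + 2 + 0. z j *\<^sub>R moment_or_apex e d j) = 0"
    using U(1,3) by (simp only: sum.reindex[OF inj] z_def o_def add_0_right simp_thms)
  then have z: "(\<Sum>j<d + 2. z j * real j ^ i) = 0" if "i \<le> d" for i
    using relation_iff_moments[of 0 z] that by blast
  obtain j where "j < d + 2" "z j \<noteq> 0"
    using U(2) by (auto simp: z_def)
  then have "z 0 \<noteq> 0"
    using moment_relation_alternates[OF z, of j] by (auto simp: sgn_zero_iff)
  \<comment> \<open>Normalise the sign, so that the positive coefficients are those at even \<open>j\<close>.\<close>
  define \<mu> where "\<mu> j = (if j < d + 2 then sgn (z 0) * z j else 0)" for j
  show ?thesis
  proof
    show "(\<Sum>j<d + 2. \<mu> j * real j ^ i) = 0" if "i \<le> d" for i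
      using z[OF that] by (simp add: \<mu>_def mult.assoc flip: sum_distrib_left)
    show "\<mu> 0 > 0" using \<open>z 0 \<noteq> 0\<close> by (simp add: \<mu>_def sgn_if)
    show "\<mu> j = 0" if "j \<ge> d + 2" for j using that by (simp add: \<mu>_def)
  qed
qed

lemma moment_circuit:
  assumes r: "r \<le> R"
  obtains lam where "affine_circuit (moment_or_apex e d ` {..<d + 2 + r}) lam"
    "2 * card {x \<in> moment_or_apex e d ` {..<d + 2 + r}. lam x > 0} = d + 2"
    "2 * card {x \<in> moment_or_apex e d ` {..<d + 2 + r}. lam x < 0} = d + 2"
proof -
  let ?p = "moment_or_apex e d" and ?I = "{..<d + 2 + r}"
  obtain \<mu> :: "nat \<Rightarrow> real" where \<mu>: "\<And>i. i \<le> d \<Longrightarrow> (\<Sum>j<d + 2. \<mu> j * real j ^ i) = 0"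
    "\<mu> 0 > 0" "\<And>j. j \<ge> d + 2 \<Longrightarrow> \<mu> j = 0"
    using exists_moment_relation by blast
  have inj: "inj_on ?p ?I"
    by (rule inj_on_subset[OF inj_moment_or_apex]) (use r in auto)
  have sgn: "sgn (\<mu> j) = (- 1) ^ j" if "j < d + 2" for j
    using moment_relation_alternates[OF \<mu>(1) that] \<mu>(2) by simp
  have iff: "\<mu> j > 0 \<longleftrightarrow> j < d + 2 \<and> even j" "\<mu> j < 0 \<longleftrightarrow> j < d + 2 \<and> odd j" for j
    using sgn[of j] \<mu>(3)[of j] sgn_1_pos[of "\<mu> j"] sgn_1_neg[of "\<mu> j"]
    by (cases "j < d + 2"; cases "even j"; simp)+
  have pos: "{j \<in> ?I. \<mu> j > 0} = {j. j < d + 2 \<and> even j}"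
    unfolding iff by auto
  have neg: "{j \<in> ?I. \<mu> j < 0} = {j. j < d + 2 \<and> odd j}"
    unfolding iff by auto
  have "even (d + 2)" using d(1) by simp
  then obtain k where k: "d + 2 = 2 * k" by (rule evenE)
  have cards: "card {j \<in> ?I. \<mu> j > 0} = k" "card {j \<in> ?I. \<mu> j < 0} = k"
    unfolding pos neg unfolding k by (rule card_even_odd_less)+
  have unique: "\<exists>\<alpha>. \<forall>j\<in>?I. z j = \<alpha> * \<mu> j"
    if z: "(\<Sum>j\<in>?I. z j) = 0" "(\<Sum>j\<in>?I. z j *\<^sub>R ?p j) = 0" for z
  proof -
    \<comment> \<open>Subtract the multiple of \<open>\<mu>\<close> that has the same coefficient at the point 0.\<close>
    define \<alpha> where "\<alpha> = z 0 / \<mu> 0"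
    define y where "y j = z j - \<alpha> * \<mu> j" for j
    have zm: "(\<Sum>j<d + 2. z j * real j ^ i) = 0" if "i \<le> d" for i
      using relation_iff_moments[OF r, of z] z that by blast
    have za: "z j = 0" if "j \<in> {d + 2..<d + 2 + r}" for j
      using relation_iff_moments[OF r, of z] z that by blast
    have ym: "(\<Sum>j<d + 2. y j * real j ^ i) = 0" if "i \<le> d" for i
    proof -
      have "(\<Sum>j<d + 2. y j * real j ^ i)
          = (\<Sum>j<d + 2. z j * real j ^ i) - \<alpha> * (\<Sum>j<d + 2. \<mu> j * real j ^ i)"
        by (simp only: y_def left_diff_distrib sum_subtractf sum_distrib_left mult.assoc)
      then show ?thesis using zm \<mu>(1) that by simp
    qed
    have "y 0 = 0" using \<mu>(2) by (simp add: y_def \<alpha>_def)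
    have "y j = 0" if "j \<in> ?I" for j
    proof (cases "j < d + 2")
      case True
      then show ?thesis
        using moment_relation_alternates[OF ym True] \<open>y 0 = 0\<close> by (simp add: sgn_zero_iff)
    next
      case False
      then show ?thesis using za[of j] \<mu>(3)[of j] that by (simp add: y_def)
    qed
    then show ?thesis by (auto simp: y_def)
  qed
  have "\<forall>j\<in>{d + 2..<d + 2 + r}. \<mu> j = 0" using \<mu>(3) by simp
  then have rel: "(\<Sum>j\<in>?I. \<mu> j) = 0" "(\<Sum>j\<in>?I. \<mu> j *\<^sub>R ?p j) = 0"
    using relation_iff_moments[OF r, of \<mu>] \<mu>(1) by blast+
  let ?lam = "\<lambda>x. \<mu> (inv_into ?I ?p x)"
  have two: "2 \<le> card {j \<in> ?I. \<mu> j > 0}" "2 \<le> card {j \<in> ?I. \<mu> j < 0}"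
    using k d(2) unfolding cards by linarith+
  have circuit: "affine_circuit (?p ` ?I) ?lam"
  proof (rule affine_circuit_family[where I = ?I and p = ?p and \<mu> = \<mu>])
    show "finite ?I" by (rule finite_lessThan)
    show "inj_on ?p ?I" by (rule inj)
    show "(\<Sum>j\<in>?I. \<mu> j) = 0" "(\<Sum>j\<in>?I. \<mu> j *\<^sub>R ?p j) = 0" by (rule rel)+
    show "2 \<le> card {j \<in> ?I. \<mu> j > 0}" "2 \<le> card {j \<in> ?I. \<mu> j < 0}" by (rule two)+
    fix z assume "(\<Sum>j\<in>?I. z j) = 0" "(\<Sum>j\<in>?I. z j *\<^sub>R ?p j) = 0"
    then show "\<exists>\<alpha>. \<forall>j\<in>?I. z j = \<alpha> * \<mu> j" by (rule unique)
  qed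
  have "card {x \<in> ?p ` ?I. ?lam x > 0} = k"
    using card_filter_image[OF inj, of "\<lambda>t. t > 0" \<mu>] cards(1) by (rule trans)
  then have lam_pos: "2 * card {x \<in> ?p ` ?I. ?lam x > 0} = d + 2"
    using k by (simp only:)
  have "card {x \<in> ?p ` ?I. ?lam x < 0} = k"
    using card_filter_image[OF inj, of "\<lambda>t. t < 0" \<mu>] cards(2) by (rule trans)
  then have lam_neg: "2 * card {x \<in> ?p ` ?I. ?lam x < 0} = d + 2"
    using k by (simp only:)
  show ?thesis
    by (rule that[OF circuit lam_pos lam_neg])
qed

lemma cyclic_moment_hull: "cyclic_polytope (d + 2) d (convex hull (moment_or_apex e d ` {..<d + 2}))"
proof -
  have "moment_or_apex e d ` {..<d + 2} = (\<lambda>t. \<Sum>i = 1..d. t ^ i *\<^sub>R e i) ` (real ` {..<d + 2})"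
    by (auto simp: moment_or_apex_def moment_curve_def image_image)
  moreover have "inj_on e {1..d}" "e ` {1..d} \<subseteq> Basis"
    using inj_e Basis_e by (auto intro: inj_on_subset)
  moreover have "card (real ` {..<d + 2}) = d + 2"
    by (simp add: card_image)
  ultimately show ?thesis
    unfolding cyclic_polytope_def
    by (intro exI[of _ e] exI[of _ "real ` {..<d + 2}"]) auto
qed

lemma aff_dim_moment_hull:
  assumes r: "r \<le> R"
  shows "aff_dim (convex hull (moment_or_apex e d ` {..<d + 2 + r})) = int (d + r)"
proof -
  have "inj_on (moment_or_apex e d) {..<d + 2 + r}"
    by (rule inj_on_subset[OF inj_moment_or_apex]) (use r in auto)
  then have "card (moment_or_apex e d ` {..<d + 2 + r}) = d + 2 + r"
    by (simp add: card_image)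
  moreover obtain lam where "affine_circuit (moment_or_apex e d ` {..<d + 2 + r}) lam"
    using moment_circuit[OF r] by blast
  ultimately show ?thesis
    using affine_circuit.aff_dim_circuit by (fastforce simp: aff_dim_convex_hull)
qed

text \<open>The next apex is the first point with a nonzero coordinate along its own basis vector, so it
  leaves the affine hull of the preceding points.\<close>

lemma fold_pyramid_moment_hull:
  assumes "r \<le> R"
  shows "fold_pyramid r (int (d + r)) (convex hull (moment_or_apex e d ` {..<d + 2}))
    (convex hull (moment_or_apex e d ` {..<d + 2 + r}))"
  using assms
proof (induction r)
  case 0
  have "aff_dim (convex hull (moment_or_apex e d ` {..<d + 2})) = int (d + 0)"
    using aff_dim_moment_hull[of 0] by (simp only: add_0_right)
  moreover have "polytope (convex hull (moment_or_apex e d ` {..<d + 2}))"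
    by (intro polytope_convex_hull finite_imageI finite_lessThan)
  ultimately show ?case by (simp only: fold_pyramid.simps add_0_right simp_thms)
next
  case (Suc r)
  let ?p = "moment_or_apex e d"
  let ?B = "convex hull (?p ` {..<d + 2 + r})" and ?a = "?p (d + 2 + r)"
  define k where "k = d + 1 + r"
  have k: "k \<in> {1..d + R}" "\<not> k \<le> d" "Suc k = d + 2 + r"
    using Suc.prems by (auto simp: k_def)
  have "?p j \<bullet> e k = 0" if "j < d + 2 + r" for j
    using inner_moment_or_apex[OF k(1), of j] k that Suc.prems by simp
  then have "?p ` {..<d + 2 + r} \<subseteq> {x. x \<bullet> e k = 0}" by auto
  moreover have "affine {x. x \<bullet> e k = 0}"
    using affine_hyperplane[of "e k" 0] by (simp add: inner_commute)
  ultimately have "affine hull ?B \<subseteq> {x. x \<bullet> e k = 0}"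
    unfolding affine_hull_convex_hull by (rule hull_minimal)
  moreover have "?a \<bullet> e k = 1"
    using inner_moment_or_apex[OF k(1), of "d + 2 + r"] k Suc.prems by simp
  ultimately have "?a \<notin> affine hull ?B" by auto
  moreover have "{..<d + 2 + Suc r} = insert (d + 2 + r) {..<d + 2 + r}" by auto
  then have "convex hull (?p ` {..<d + 2 + Suc r}) = convex hull (insert ?a ?B)"
    by (simp only: image_insert hull_insert[symmetric])
  moreover have "polytope ?B" by (simp add: polytope_convex_hull)
  moreover have "aff_dim ?B = int (d + Suc r) - 1"
    using aff_dim_moment_hull[of r] Suc.prems by simp
  ultimately have "pyramid (int (d + Suc r)) ?B (convex hull (?p ` {..<d + 2 + Suc r}))"
    unfolding pyramid_def by blast
  moreover have "int (d + Suc r) - 1 = int (d + r)" by simp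
  then have "fold_pyramid r (int (d + Suc r) - 1) (convex hull (?p ` {..<d + 2})) ?B"
    using Suc by (simp only:)
  ultimately show ?case by (simp only: fold_pyramid.simps) blast
qed

end

section \<open>The incidence polytope of a 3-colored polytope\<close>

lemma inj_on_incidence_vector:
  fixes l :: "'v::finite \<Rightarrow> 'a::euclidean_space"
  assumes P: "polytope P" and l: "range l = {x. x extreme_point_of P}"
  shows "inj_on (incidence_vector l) (two_faces P)"
proof (rule inj_onI)
  fix f g assume f: "f \<in> two_faces P" and g: "g \<in> two_faces P"
    and eq: "incidence_vector l f = incidence_vector l g"
  have same: "l i \<in> f \<longleftrightarrow> l i \<in> g" for i
  proof -
    have "incidence_vector l f $ i = incidence_vector l g $ i" by (simp only: eq)
    then show ?thesis by (simp add: incidence_vector_def split: if_splits)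
  qed
  have hull: "h = convex hull (range l \<inter> h)" if "h \<in> two_faces P" for h
    using polytope_eq_hull_vertices[OF P, of h] that unfolding l two_faces_def
    by (simp add: Collect_conj_eq)
  have "range l \<inter> f = range l \<inter> g"
    using same by blast
  then show "f = g"
    using hull[OF f] hull[OF g] by simp
qed

lemma sum_incidence_component:
  fixes l :: "'v::finite \<Rightarrow> 'a::euclidean_space"
  assumes P: "polytope P"
  shows "(\<Sum>f\<in>two_faces P. z f *\<^sub>R incidence_vector l f) $ i = (\<Sum>f\<in>facets_at P (l i). z f)"
proof -
  have "(\<Sum>f\<in>two_faces P. z f *\<^sub>R incidence_vector l f) $ i
      = (\<Sum>f\<in>two_faces P. if l i \<in> f then z f else 0)"
    by (simp add: incidence_vector_def if_distrib cong: if_cong)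
  also have "\<dots> = (\<Sum>f\<in>facets_at P (l i). z f)"
    unfolding facets_at_def by (rule sum.inter_filter[OF finite_two_faces[OF P], symmetric])
  finally show ?thesis .
qed

lemma sum_over_colors:
  assumes P: "polytope P" and c: "proper_3_coloring P c"
  shows "(\<Sum>f\<in>two_faces P. a (c f)) = (\<Sum>i\<in>{1, 2, 3}. real (card (color_class P c i)) * a i)"
proof -
  have "(\<Sum>f\<in>two_faces P. a (c f)) = (\<Sum>i\<in>{1, 2, 3}. \<Sum>f\<in>{f \<in> two_faces P. c f = i}. a (c f))"
    using c by (intro sum.group[symmetric] finite_two_faces[OF P]) (auto simp: proper_3_coloring_def)
  also have "\<dots> = (\<Sum>i\<in>{1, 2, 3}. \<Sum>f\<in>color_class P c i. a i)"
    by (intro sum.cong) (auto simp: color_class_def)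
  finally show ?thesis by simp
qed

definition color_sign :: "nat \<Rightarrow> real" where
  "color_sign i = (if i = 2 then 1 else if i = 1 then - 1 else 0)"

text \<open>Since \<open>m 1 = m 2\<close>, the difference of the two color sums is an affine and not only a linear relation;
  since \<open>m 3 \<noteq> m 1\<close>, it is the only one.\<close>

lemma incidence_circuit:
  fixes l :: "'v::finite \<Rightarrow> 'a::euclidean_space"
  assumes P: "simple_3_polytope P" and c: "proper_3_coloring P c"
    and l: "range l = {x. x extreme_point_of P}"
    and m: "\<And>i. m i = card (color_class P c i)"
    and ineq: "m 3 > m 2" "m 2 = m 1" "m 1 \<ge> 2"
  defines "S \<equiv> incidence_vector l ` two_faces P"
  obtains lam where "affine_circuit S lam"
    "{x \<in> S. lam x > 0} = incidence_vector l ` color_class P c 2"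
    "{x \<in> S. lam x < 0} = incidence_vector l ` color_class P c 1"
proof -
  let ?F = "two_faces P" and ?x = "incidence_vector l"
  let ?mu = "\<lambda>f. color_sign (c f)"
  let ?lam = "\<lambda>x. ?mu (inv_into ?F ?x x)"
  have poly: "polytope P" using simple_3_polytopeD[OF P] by blast
  note inj = inj_on_incidence_vector[OF poly l]
  have lam: "?lam (?x f) = ?mu f" if "f \<in> ?F" for f
    using inv_into_f_f[OF inj that] by simp
  have sets: "{f \<in> ?F. ?mu f > 0} = color_class P c 2" "{f \<in> ?F. ?mu f < 0} = color_class P c 1"
    by (auto simp: color_sign_def color_class_def split: if_splits)
  have circuit: "affine_circuit (?x ` ?F) ?lam"
  proof (rule affine_circuit_family[where I = ?F and p = ?x and \<mu> = ?mu])
    show "finite ?F" by (rule finite_two_faces[OF poly])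
    show "inj_on ?x ?F" by (rule inj)
    show "(\<Sum>f\<in>?F. ?mu f) = 0"
      using sum_over_colors[OF poly c, of color_sign] ineq by (simp add: color_sign_def flip: m)
    have "(\<Sum>f\<in>?F. ?mu f *\<^sub>R ?x f) $ i = 0" for i
    proof -
      have "l i extreme_point_of P" using l by blast
      then have "bij_betw c (facets_at P (l i)) {1, 2, 3}"
        by (rule coloring_bij_at_vertex[OF P c])
      then have "(\<Sum>f\<in>facets_at P (l i). ?mu f) = (\<Sum>j\<in>{1, 2, 3}. color_sign j)"
        by (rule sum.reindex_bij_betw)
      then show ?thesis
        by (simp only: sum_incidence_component[OF poly]) (simp add: color_sign_def)
    qed
    then show "(\<Sum>f\<in>?F. ?mu f *\<^sub>R ?x f) = 0"
      by (simp only: vec_eq_iff zero_index) blast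
    show "2 \<le> card {f \<in> ?F. ?mu f > 0}" "2 \<le> card {f \<in> ?F. ?mu f < 0}"
      using ineq unfolding sets m by linarith+
    fix z assume z: "(\<Sum>f\<in>?F. z f) = 0" "(\<Sum>f\<in>?F. z f *\<^sub>R ?x f) = 0"
    have "(\<Sum>f\<in>facets_at P v. z f) = 0" if v: "v extreme_point_of P" for v
    proof -
      obtain i where "v = l i" using v l by blast
      then show ?thesis
        using sum_incidence_component[OF poly, of z l i] z(2) by simp
    qed
    then obtain a where a: "\<And>f. f \<in> ?F \<Longrightarrow> z f = a (c f)" "a 1 + a 2 + a 3 = 0"
      using relation_constant_on_colors[OF P c] by blast
    have "real (m 1) * a 1 + real (m 2) * a 2 + real (m 3) * a 3 = 0"
      using sum_over_colors[OF poly c, of a] z(1) a(1) by (simp add: m)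
    \<comment> \<open>Eliminate \<open>a 1\<close> and \<open>a 2\<close>, whose classes have equal size.\<close>
    moreover have "(real (m 3) - real (m 1)) * a 3
        = (real (m 1) * a 1 + real (m 2) * a 2 + real (m 3) * a 3) - real (m 1) * (a 1 + a 2 + a 3)"
      using ineq(2) by (simp add: algebra_simps)
    ultimately have "(real (m 3) - real (m 1)) * a 3 = 0"
      using a(2) by (simp only: mult_zero_right diff_0_right)
    then have "a 3 = 0" using ineq by simp
    have "z f = a 2 * ?mu f" if f: "f \<in> ?F" for f
    proof -
      have "c f \<in> {1, 2, 3}" using c f by (auto simp: proper_3_coloring_def)
      then show ?thesis using a(1)[OF f] a(2) \<open>a 3 = 0\<close> by (auto simp: color_sign_def)
    qed
    then show "\<exists>\<alpha>. \<forall>f\<in>?F. z f = \<alpha> * ?mu f" by blast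
  qed
  have "{x \<in> ?x ` ?F. ?lam x > 0} = ?x ` {f \<in> ?F. ?mu f > 0}"
    "{x \<in> ?x ` ?F. ?lam x < 0} = ?x ` {f \<in> ?F. ?mu f < 0}"
    using lam by auto
  then show ?thesis
    using that[of ?lam] circuit unfolding sets S_def by blast
qed

theorem proposition4p3:
  fixes P :: "'a::euclidean_space set"
    and c :: "'a set \<Rightarrow> nat"
    and l :: "'v::finite \<Rightarrow> 'a"
    and n :: nat
    and m :: "nat \<Rightarrow> nat"
    and V :: "nat \<Rightarrow> (real ^ 'v) set"
    and S Pt :: "(real ^ 'v) set"
  assumes "three_colorable P"
    and "proper_3_coloring P c"
    and "bij_betw l UNIV {x. x extreme_point_of P}"
    and "CARD('v) = 2 * n"
    and "\<And>i. m i = card (color_class P c i)"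
    and "\<And>i. V i = incidence_vector l ` color_class P c i"
    and "S = V 1 \<union> V 2 \<union> V 3"
    and "Pt = incidence_polytope l P"
    and "m 3 > m 2" and "m 2 = m 1" and "m 1 \<ge> 2"
  shows "polytope_gale_diagram Pt
           (replicate_mset (m 3) (0::real) + replicate_mset (m 2) 1 + replicate_mset (m 1) (- 1))
       \<and> (\<forall>J. J \<subset> S \<longrightarrow>
           (proper_face_of (convex hull J) Pt \<longleftrightarrow>
             (\<not> V 1 \<subseteq> J \<and> \<not> V 2 \<subseteq> J) \<or> V 1 \<union> V 2 \<subseteq> J))
       \<and> \<not> simplicial_polytope Pt
       \<and> (\<exists>K T :: (real ^ 'v) set.
           cyclic_polytope (2 * m 2) (2 * m 2 - 2) K \<and>
           fold_pyramid (m 3) (int n) K T \<and>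
           combinatorially_equivalent Pt T)"
proof -
  note c = assms(2) and m = assms(5) and V = assms(6) and ineq = assms(9-11)
  have P: "simple_3_polytope P" using assms(1) by (simp add: three_colorable_def)
  then have poly: "polytope P" using simple_3_polytopeD by blast
  have l: "range l = {x. x extreme_point_of P}"
    using assms(3) by (simp add: bij_betw_def)
  note inj = inj_on_incidence_vector[OF poly l]
  let ?F = "two_faces P"
  have F: "?F = color_class P c 1 \<union> color_class P c 2 \<union> color_class P c 3"
    using c by (auto simp: color_class_def proper_3_coloring_def)
  have S: "S = incidence_vector l ` ?F"
    unfolding assms(7) V F by blast
  have Pt: "Pt = convex hull S"
    unfolding assms(8) incidence_polytope_def S ..
  have cardV: "card (V i) = m i" for i
    unfolding V m by (rule card_image, rule inj_on_subset[OF inj]) (auto simp: color_class_def)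
  have "real (card ?F) = real (m 1 + m 2 + m 3)"
    using sum_over_colors[OF poly c, of "\<lambda>_. 1"] by (simp add: m)
  then have "card ?F = m 1 + m 2 + m 3" by (simp only: of_nat_eq_iff)
  then have cardS: "card S = m 1 + m 2 + m 3"
    using card_image[OF inj] S by simp
  have "2 * card ?F = 2 * n + 4"
    using simple_3_polytope_facet_count[OF P] bij_betw_same_card[OF assms(3)] assms(4) by simp
  then have n: "n + 2 = m 1 + m 2 + m 3"
    using \<open>card ?F = m 1 + m 2 + m 3\<close> by simp
  obtain lam where circuit: "affine_circuit S lam"
    and pos: "{x \<in> S. lam x > 0} = V 2" and neg: "{x \<in> S. lam x < 0} = V 1"
    using incidence_circuit[OF P c l m ineq] unfolding S V by blast
  interpret affine_circuit S lam by fact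
  have "polytope_gale_diagram Pt
      (replicate_mset (m 3) (0::real) + replicate_mset (m 2) 1 + replicate_mset (m 1) (- 1))"
    using gale_diagram_circuit unfolding pos neg cardV cardS Pt by simp
  moreover have "proper_face_of (convex hull J) Pt \<longleftrightarrow>
      (\<not> V 1 \<subseteq> J \<and> \<not> V 2 \<subseteq> J) \<or> V 1 \<union> V 2 \<subseteq> J" if J: "J \<subset> S" for J
  proof -
    have "convex hull J \<noteq> convex hull S"
      using hull_Int[of J] hull_Int[of S] J by blast
    then have "proper_face_of (convex hull J) Pt \<longleftrightarrow> balanced J"
      using face_iff_balanced[of J] J by (auto simp: proper_face_of_def Pt)
    also have "\<dots> \<longleftrightarrow> (V 2 \<subseteq> J \<longleftrightarrow> V 1 \<subseteq> J)"
      using J by (auto simp: balanced_def pos neg)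
    finally show ?thesis by blast
  qed
  moreover have "\<not> simplicial_polytope Pt"
  proof -
    have "card (V 2 \<union> V 1) \<le> m 2 + m 1"
      using card_Un_le[of "V 2" "V 1"] cardV by simp
    then have "V 2 \<union> V 1 \<noteq> S" using cardS ineq by auto
    then show ?thesis using not_simplicial by (simp add: pos neg Pt)
  qed
  moreover have "\<exists>K T :: (real ^ 'v) set. cyclic_polytope (2 * m 2) (2 * m 2 - 2) K \<and>
      fold_pyramid (m 3) (int n) K T \<and> combinatorially_equivalent Pt T"
  proof -
    define d where "d = 2 * m 2 - 2"
    have d: "d + 2 = 2 * m 2" "d + m 3 = n" "even d" "d \<ge> 2"
      using ineq n by (auto simp: d_def)
    obtain e :: "nat \<Rightarrow> real ^ 'v" where e: "bij_betw e {1..card (Basis :: (real ^ 'v) set)} Basis"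
      using ex_bij_betw_nat_finite_1[OF finite_Basis] by blast
    have sub: "{1..d + m 3} \<subseteq> {1..card (Basis :: (real ^ 'v) set)}"
      using assms(4) d by simp
    interpret frame: coordinate_frame e d "m 3"
    proof
      show "inj_on e {1..d + m 3}"
        using e sub by (meson bij_betw_imp_inj_on inj_on_subset)
      show "e ` {1..d + m 3} \<subseteq> Basis"
        using image_mono[OF sub, of e] bij_betw_imp_surj_on[OF e] by blast
    qed (use d in auto)
    let ?p = "moment_or_apex e d"
    obtain lam' where lam': "affine_circuit (?p ` {..<d + 2 + m 3}) lam'"
      "2 * card {x \<in> ?p ` {..<d + 2 + m 3}. lam' x > 0} = d + 2"
      "2 * card {x \<in> ?p ` {..<d + 2 + m 3}. lam' x < 0} = d + 2"
      using frame.moment_circuit[OF order_refl] by blast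
    have "combinatorially_equivalent Pt (convex hull (?p ` {..<d + 2 + m 3}))"
      unfolding Pt
    proof (rule circuits_same_counts_equivalent[OF circuit lam'(1)])
      show "card S = card (?p ` {..<d + 2 + m 3})"
        unfolding card_image[OF frame.inj_moment_or_apex] card_lessThan using cardS d n by linarith
      show "card {x \<in> S. lam x > 0} = card {x \<in> ?p ` {..<d + 2 + m 3}. lam' x > 0}"
        unfolding pos cardV using lam'(2) d(1) by linarith
      show "card {x \<in> S. lam x < 0} = card {x \<in> ?p ` {..<d + 2 + m 3}. lam' x < 0}"
        unfolding neg cardV using lam'(3) d(1) ineq by linarith
    qed
    moreover have "fold_pyramid (m 3) (int n) (convex hull (?p ` {..<d + 2})) (convex hull (?p ` {..<d + 2 + m 3}))"
      using frame.fold_pyramid_moment_hull[OF order_refl] by (simp only: d(2))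
    moreover have "cyclic_polytope (2 * m 2) (2 * m 2 - 2) (convex hull (?p ` {..<d + 2}))"
      using frame.cyclic_moment_hull unfolding d(1) by (simp only: d_def)
    ultimately show ?thesis by blast
  qed
  ultimately show ?thesis by blast
qed

end
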